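(* Linear tape-bounded Turing machines recognize precisely the same languages as $\mathrm{GGMSC}$, $\mathrm{GMSC}$ and $\mathrm{MSC}$. More precisely: (1) given a program $\Lambda$ of $\mathrm{GGMSC}$ and $k\in\mathbb{N}$, there is a deterministic $k$-bounded Turing machine $T_\Lambda$ such that if a word $\mathbf{w}$ is $k$-accepted (resp. $k$-rejected) by $\Lambda$ then $\mathbf{w}$ is accepted (resp. rejected) by $T_\Lambda$; (2) given a deterministic $k$-bounded Turing machine $T$, there is a program $\Lambda_T$ of $\mathrm{MSC}$ such that if $\mathbf{w}$ is accepted (resp. rejected) by $T$ then $\mathbf{w}$ is $k$-accepted (resp. $k$-rejected) by $\Lambda_T$.
   Context: $\mathrm{GGMSC}$ programs: for each schema variable $X$ a base rule $X(0) :- \varphi_X$ ($\varphi_X$ a formula of graded modal logic with counting global modality) and an induction rule $X :- \psi_X$ (may contain schema variables as atoms); $X^0=\varphi_X$, $X^{n+1}$ is $\psi_X$ with each $Y$ replaced by $Y^n$. $\mathrm{GMSC}$ omits global modalities; $\mathrm{MSC}$ further allows only $\Diamond,\Box$. Programs carry disjoint sets of accepting and rejecting predicates; $(M,w)$ is accepted (resp. rejected) if for some $n$ an accepting (resp. rejecting) $X$ has $M,w\models X^n$ and no rejecting (resp. accepting) $Y$ has $M,w\models Y^m$ for any $m\leq n$. Alphabet symbols are identified with proposition symbols in $\Pi$; $p_\blacksquare,p_\mathbf{l},p_\mathbf{r}\notin\Pi$. The $\ell$-extended word model of $\mathbf{s}\in\Pi^*$ has domain $[0;|\mathbf{s}|+\ell+1]$,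 $R$ the symmetric closure of the successor relation, node $i\in[1;|\mathbf{s}|]$ labeled $\{\mathbf{s}(i)\}$, nodes $|\mathbf{s}|<j\leq|\mathbf{s}|+\ell$ labeled $\{p_\blacksquare\}$, node $0$ labeled $\{p_\mathbf{l}\}$, node $|\mathbf{s}|+\ell+1$ labeled $\{p_\mathbf{r}\}$. $\Lambda$ $k$-accepts (resp. $k$-rejects) $\mathbf{s}$ if it accepts (resp. rejects) the $k$-extended word model pointed at node $1$; a language $L$ is recognized by $\Lambda$ if for some $k$, $\Lambda$ $k$-accepts exactly the strings in $L$. A deterministic $k$-bounded Turing machine is a deterministic Turing machine with left end marker $E_\mathbf{l}$, right end marker $E_\mathbf{r}$, disjoint accepting and rejecting halting state sets, whose transitions never overwrite or move past the end markers, and whose initial tape is $E_\mathbf{l}\mathbf{s}\blacksquare^k E_\mathbf{r}$ with the head on the first input symbol; a linear tape-bounded TM is a $k$-bounded one for some $k$. *)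

theory Defs
  imports Main
begin

section \<open>Graded modal logic with counting global modality\<close>

text \<open>
  The plain modalities are the grade-one diamond and its dual. \<open>Var\<close> is a schema variable
  used as an atom.
\<close>

datatype ('p, 'v) fm =
    Top
  | Prop 'p
  | Var 'v
  | Neg "('p, 'v) fm"
  | Conj "('p, 'v) fm" "('p, 'v) fm"
  | Dia nat "('p, 'v) fm"
  | Glob nat "('p, 'v) fm"

abbreviation Diamond :: "('p, 'v) fm \<Rightarrow> ('p, 'v) fm" where
  "Diamond f \<equiv> Dia 1 f"

abbreviation Box :: "('p, 'v) fm \<Rightarrow> ('p, 'v) fm" where
  "Box f \<equiv> Neg (Dia 1 (Neg f))"

primrec fm_props :: "('p, 'v) fm \<Rightarrow> 'p set" where
  "fm_props Top = {}"
| "fm_props (Prop p) = {p}"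
| "fm_props (Var X) = {}"
| "fm_props (Neg f) = fm_props f"
| "fm_props (Conj f g) = fm_props f \<union> fm_props g"
| "fm_props (Dia n f) = fm_props f"
| "fm_props (Glob n f) = fm_props f"

primrec fm_vars :: "('p, 'v) fm \<Rightarrow> 'v set" where
  "fm_vars Top = {}"
| "fm_vars (Prop p) = {}"
| "fm_vars (Var X) = {X}"
| "fm_vars (Neg f) = fm_vars f"
| "fm_vars (Conj f g) = fm_vars f \<union> fm_vars g"
| "fm_vars (Dia n f) = fm_vars f"
| "fm_vars (Glob n f) = fm_vars f"

primrec global_free :: "('p, 'v) fm \<Rightarrow> bool" where
  "global_free Top \<longleftrightarrow> True"
| "global_free (Prop p) \<longleftrightarrow> True"
| "global_free (Var X) \<longleftrightarrow> True"
| "global_free (Neg f) \<longleftrightarrow> global_free f"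
| "global_free (Conj f g) \<longleftrightarrow> global_free f \<and> global_free g"
| "global_free (Dia n f) \<longleftrightarrow> global_free f"
| "global_free (Glob n f) \<longleftrightarrow> False"

primrec ungraded :: "('p, 'v) fm \<Rightarrow> bool" where
  "ungraded Top \<longleftrightarrow> True"
| "ungraded (Prop p) \<longleftrightarrow> True"
| "ungraded (Var X) \<longleftrightarrow> True"
| "ungraded (Neg f) \<longleftrightarrow> ungraded f"
| "ungraded (Conj f g) \<longleftrightarrow> ungraded f \<and> ungraded g"
| "ungraded (Dia n f) \<longleftrightarrow> n = 1 \<and> ungraded f"
| "ungraded (Glob n f) \<longleftrightarrow> n = 1 \<and> ungraded f"

record ('w, 'p) kripke =
  worlds :: "'w set"
  rel :: "('w \<times> 'w) set"
  label :: "'w \<Rightarrow> 'p set"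

definition at_least :: "nat \<Rightarrow> 'w set \<Rightarrow> bool" where
  "at_least n S \<longleftrightarrow> infinite S \<or> n \<le> card S"

text \<open>
  The clause for \<open>Var\<close> is a dummy: truth is only ever evaluated for the iteration formulas of a
  program, and these contain no schema variables.
\<close>

primrec sat :: "('w, 'p) kripke \<Rightarrow> 'w \<Rightarrow> ('p, 'v) fm \<Rightarrow> bool" where
  "sat M w Top \<longleftrightarrow> True"
| "sat M w (Prop p) \<longleftrightarrow> p \<in> label M w"
| "sat M w (Var X) \<longleftrightarrow> False"
| "sat M w (Neg f) \<longleftrightarrow> \<not> sat M w f"
| "sat M w (Conj f g) \<longleftrightarrow> sat M w f \<and> sat M w g"
| "sat M w (Dia n f) \<longleftrightarrow> at_least n {v \<in> worlds M. (w, v) \<in> rel M \<and> sat M v f}"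
| "sat M w (Glob n f) \<longleftrightarrow> at_least n {v \<in> worlds M. sat M v f}"


section \<open>Programs of GGMSC, GMSC and MSC\<close>

record ('p, 'v) program =
  svars :: "'v set"
  base :: "'v \<Rightarrow> ('p, 'v) fm"
  ind :: "'v \<Rightarrow> ('p, 'v) fm"
  accepting :: "'v set"
  rejecting :: "'v set"

text \<open>The set \<open>P\<close> is the vocabulary of proposition symbols that a program may use.\<close>

definition GGMSC_program :: "'p set \<Rightarrow> ('p, 'v) program \<Rightarrow> bool" where
  "GGMSC_program P \<Lambda> \<longleftrightarrow>
     finite (svars \<Lambda>) \<and>
     (\<forall>X \<in> svars \<Lambda>.
        fm_props (base \<Lambda> X) \<subseteq> P \<and> fm_vars (base \<Lambda> X) = {} \<and>
        fm_props (ind \<Lambda> X) \<subseteq> P \<and> fm_vars (ind \<Lambda> X) \<subseteq> svars \<Lambda>) \<and>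
     accepting \<Lambda> \<subseteq> svars \<Lambda> \<and> rejecting \<Lambda> \<subseteq> svars \<Lambda> \<and>
     accepting \<Lambda> \<inter> rejecting \<Lambda> = {}"

definition GMSC_program :: "'p set \<Rightarrow> ('p, 'v) program \<Rightarrow> bool" where
  "GMSC_program P \<Lambda> \<longleftrightarrow>
     GGMSC_program P \<Lambda> \<and>
     (\<forall>X \<in> svars \<Lambda>. global_free (base \<Lambda> X) \<and> global_free (ind \<Lambda> X))"

definition MSC_program :: "'p set \<Rightarrow> ('p, 'v) program \<Rightarrow> bool" where
  "MSC_program P \<Lambda> \<longleftrightarrow>
     GMSC_program P \<Lambda> \<and>
     (\<forall>X \<in> svars \<Lambda>. ungraded (base \<Lambda> X) \<and> ungraded (ind \<Lambda> X))"

primrec subst_vars :: "('v \<Rightarrow> ('p, 'v) fm) \<Rightarrow> ('p, 'v) fm \<Rightarrow> ('p, 'v) fm" where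
  "subst_vars \<sigma> Top = Top"
| "subst_vars \<sigma> (Prop p) = Prop p"
| "subst_vars \<sigma> (Var X) = \<sigma> X"
| "subst_vars \<sigma> (Neg f) = Neg (subst_vars \<sigma> f)"
| "subst_vars \<sigma> (Conj f g) = Conj (subst_vars \<sigma> f) (subst_vars \<sigma> g)"
| "subst_vars \<sigma> (Dia n f) = Dia n (subst_vars \<sigma> f)"
| "subst_vars \<sigma> (Glob n f) = Glob n (subst_vars \<sigma> f)"

primrec iter_fm :: "('p, 'v) program \<Rightarrow> nat \<Rightarrow> 'v \<Rightarrow> ('p, 'v) fm" where
  "iter_fm \<Lambda> 0 = base \<Lambda>"
| "iter_fm \<Lambda> (Suc n) = (\<lambda>X. subst_vars (iter_fm \<Lambda> n) (ind \<Lambda> X))"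

definition program_accepts :: "('p, 'v) program \<Rightarrow> ('w, 'p) kripke \<Rightarrow> 'w \<Rightarrow> bool" where
  "program_accepts \<Lambda> M w \<longleftrightarrow>
     (\<exists>n. (\<exists>X \<in> accepting \<Lambda>. sat M w (iter_fm \<Lambda> n X)) \<and>
          (\<forall>Y \<in> rejecting \<Lambda>. \<forall>m \<le> n. \<not> sat M w (iter_fm \<Lambda> m Y)))"

definition program_rejects :: "('p, 'v) program \<Rightarrow> ('w, 'p) kripke \<Rightarrow> 'w \<Rightarrow> bool" where
  "program_rejects \<Lambda> M w \<longleftrightarrow>
     (\<exists>n. (\<exists>X \<in> rejecting \<Lambda>. sat M w (iter_fm \<Lambda> n X)) \<and>
          (\<forall>Y \<in> accepting \<Lambda>. \<forall>m \<le> n. \<not> sat M w (iter_fm \<Lambda> m Y)))"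


section \<open>Extended word models and languages of programs\<close>

text \<open>
  The arguments \<open>pb pl pr\<close> are the proposition symbols marking the padding cells, the left end
  and the right end. Node \<open>i\<close> with \<open>1 \<le> i \<le> length s\<close> carries letter \<open>s ! (i - 1)\<close>.
\<close>

definition ext_word_model :: "'p \<Rightarrow> 'p \<Rightarrow> 'p \<Rightarrow> nat \<Rightarrow> 'p list \<Rightarrow> (nat, 'p) kripke" where
  "ext_word_model pb pl pr l s =
     \<lparr> worlds = {0..length s + l + 1},
       rel = {(i, j). i \<le> length s + l + 1 \<and> j \<le> length s + l + 1 \<and> (j = Suc i \<or> i = Suc j)},
       label = (\<lambda>i. if i = 0 then {pl}
                    else if i \<le> length s then {s ! (i - 1)}
                    else if i \<le> length s + l then {pb}
                    else if i = length s + l + 1 then {pr}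
                    else {}) \<rparr>"

definition k_accepts ::
    "'p \<Rightarrow> 'p \<Rightarrow> 'p \<Rightarrow> nat \<Rightarrow> ('p, 'v) program \<Rightarrow> 'p list \<Rightarrow> bool" where
  "k_accepts pb pl pr k \<Lambda> s \<longleftrightarrow> program_accepts \<Lambda> (ext_word_model pb pl pr k s) 1"

definition k_rejects ::
    "'p \<Rightarrow> 'p \<Rightarrow> 'p \<Rightarrow> nat \<Rightarrow> ('p, 'v) program \<Rightarrow> 'p list \<Rightarrow> bool" where
  "k_rejects pb pl pr k \<Lambda> s \<longleftrightarrow> program_rejects \<Lambda> (ext_word_model pb pl pr k s) 1"

definition program_recognizes ::
    "'p set \<Rightarrow> 'p \<Rightarrow> 'p \<Rightarrow> 'p \<Rightarrow> ('p, 'v) program \<Rightarrow> 'p list set \<Rightarrow> bool" where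
  "program_recognizes A pb pl pr \<Lambda> L \<longleftrightarrow>
     L \<subseteq> lists A \<and> (\<exists>k. \<forall>s \<in> lists A. k_accepts pb pl pr k \<Lambda> s \<longleftrightarrow> s \<in> L)"


section \<open>Linear tape-bounded Turing machines\<close>

text \<open>\<open>Work\<close> supplies auxiliary tape symbols beyond the input alphabet, blank and end markers.\<close>

datatype ('p, 'g) tsym = Inp 'p | Blank | EndL | EndR | Work 'g

datatype move = MoveL | Stay | MoveR

record ('q, 'g, 'p) tm =
  tm_states :: "'q set"
  tm_symbols :: "('p, 'g) tsym set"
  tm_start :: 'q
  tm_trans :: "'q \<Rightarrow> ('p, 'g) tsym \<Rightarrow> 'q \<times> ('p, 'g) tsym \<times> move"
  tm_acc :: "'q set"
  tm_rej :: "'q set"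

text \<open>
  The values of the transition function matter only on non-halting states and tape symbols of the
  machine, where it is total. The bound \<open>k\<close> of a \<open>k\<close>-bounded machine imposes no condition on
  these data: it only determines the initial tape.
\<close>

definition bounded_TM :: "'p set \<Rightarrow> ('q, 'g, 'p) tm \<Rightarrow> bool" where
  "bounded_TM A T \<longleftrightarrow>
     finite (tm_states T) \<and> finite (tm_symbols T) \<and>
     Inp ` A \<union> {Blank, EndL, EndR} \<subseteq> tm_symbols T \<and>
     tm_start T \<in> tm_states T \<and>
     tm_acc T \<subseteq> tm_states T \<and> tm_rej T \<subseteq> tm_states T \<and> tm_acc T \<inter> tm_rej T = {} \<and>
     (\<forall>q \<in> tm_states T - (tm_acc T \<union> tm_rej T). \<forall>a \<in> tm_symbols T.
        case tm_trans T q a of (q', b, d) \<Rightarrow>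
          q' \<in> tm_states T \<and> b \<in> tm_symbols T \<and>
          (a = EndL \<longrightarrow> b = EndL \<and> d \<noteq> MoveL) \<and>
          (a = EndR \<longrightarrow> b = EndR \<and> d \<noteq> MoveR))"

text \<open>A configuration consists of the state, the tape contents and the head position.\<close>

type_synonym ('q, 'g, 'p) config = "'q \<times> ('p, 'g) tsym list \<times> nat"

definition init_tape :: "nat \<Rightarrow> 'p list \<Rightarrow> ('p, 'g) tsym list" where
  "init_tape k s = [EndL] @ map Inp s @ replicate k Blank @ [EndR]"

definition init_config :: "('q, 'g, 'p) tm \<Rightarrow> nat \<Rightarrow> 'p list \<Rightarrow> ('q, 'g, 'p) config" where
  "init_config T k s = (tm_start T, init_tape k s, 1)"

fun move_head :: "move \<Rightarrow> nat \<Rightarrow> nat" where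
  "move_head MoveL h = h - 1"
| "move_head Stay h = h"
| "move_head MoveR h = h + 1"

fun tm_step :: "('q, 'g, 'p) tm \<Rightarrow> ('q, 'g, 'p) config \<Rightarrow> ('q, 'g, 'p) config" where
  "tm_step T (q, t, h) =
     (if q \<in> tm_acc T \<union> tm_rej T then (q, t, h)
      else case tm_trans T q (t ! h) of (q', b, d) \<Rightarrow> (q', t[h := b], move_head d h))"

definition tm_accepts :: "nat \<Rightarrow> ('q, 'g, 'p) tm \<Rightarrow> 'p list \<Rightarrow> bool" where
  "tm_accepts k T s \<longleftrightarrow> (\<exists>n. fst ((tm_step T ^^ n) (init_config T k s)) \<in> tm_acc T)"

definition tm_rejects :: "nat \<Rightarrow> ('q, 'g, 'p) tm \<Rightarrow> 'p list \<Rightarrow> bool" where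
  "tm_rejects k T s \<longleftrightarrow> (\<exists>n. fst ((tm_step T ^^ n) (init_config T k s)) \<in> tm_rej T)"

definition tm_recognizes :: "'p set \<Rightarrow> nat \<Rightarrow> ('q, 'g, 'p) tm \<Rightarrow> 'p list set \<Rightarrow> bool" where
  "tm_recognizes A k T L \<longleftrightarrow>
     L \<subseteq> lists A \<and> (\<forall>s \<in> lists A. tm_accepts k T s \<longleftrightarrow> s \<in> L)"


section \<open>Language classes\<close>

text \<open>
  States, auxiliary tape symbols and schema variables are drawn from \<^typ>\<open>nat\<close>; as all these sets
  are finite, this covers every machine and every program up to renaming.
\<close>

type_synonym 'p machine = "(nat, nat, 'p) tm"
type_synonym 'p prog = "('p, nat) program"

definition linear_TM_language :: "'p set \<Rightarrow> 'p list set \<Rightarrow> bool" where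
  "linear_TM_language A L \<longleftrightarrow>
     (\<exists>k. \<exists>T :: 'p machine. bounded_TM A T \<and> tm_recognizes A k T L)"

definition GGMSC_language :: "'p set \<Rightarrow> 'p \<Rightarrow> 'p \<Rightarrow> 'p \<Rightarrow> 'p list set \<Rightarrow> bool" where
  "GGMSC_language A pb pl pr L \<longleftrightarrow>
     (\<exists>\<Lambda> :: 'p prog. GGMSC_program (A \<union> {pb, pl, pr}) \<Lambda> \<and> program_recognizes A pb pl pr \<Lambda> L)"

definition GMSC_language :: "'p set \<Rightarrow> 'p \<Rightarrow> 'p \<Rightarrow> 'p \<Rightarrow> 'p list set \<Rightarrow> bool" where
  "GMSC_language A pb pl pr L \<longleftrightarrow>
     (\<exists>\<Lambda> :: 'p prog. GMSC_program (A \<union> {pb, pl, pr}) \<Lambda> \<and> program_recognizes A pb pl pr \<Lambda> L)"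

definition MSC_language :: "'p set \<Rightarrow> 'p \<Rightarrow> 'p \<Rightarrow> 'p \<Rightarrow> 'p list set \<Rightarrow> bool" where
  "MSC_language A pb pl pr L \<longleftrightarrow>
     (\<exists>\<Lambda> :: 'p prog. MSC_program (A \<union> {pb, pl, pr}) \<Lambda> \<and> program_recognizes A pb pl pr \<Lambda> L)"

end

theory Submission
  imports Defs
begin

text \<open>
  A machine is simulated in lockstep by a program whose schema variables describe the
  configuration: the truth values at node \<open>i\<close> after \<open>n\<close> iterations tell the content of cell \<open>i\<close> and
  whether the head is there. Since every move of the head is local, ungraded diamonds suffice; the
  outcome then spreads from the head to node \<open>1\<close>. Conversely, the truth values of all subformulas
  of the rules are computed cell by cell, one level of the syntax tree at a time. One level needs
  only the values at the two neighbours and the truncated number of nodes satisfying each formula,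
  so a machine can compute it by sweeping over the tape once in each direction. As the outcome is
  checked after every step, acceptance and rejection are preserved in both directions, which also
  gives equality of the recognized languages.
\<close>

section \<open>Truth under an environment for the schema variables\<close>

text \<open>The formulas of \<open>iter_fm\<close> grow with every iteration and \<open>sat\<close>
  makes all schema variables false, so rules are evaluated by \<open>esat\<close> under an
  environment holding the values of the previous iterate. Both simulations change the timing of a
  verdict. A program learns it at node 1 only after it has travelled there from the head; this is
  harmless because a halted machine is frozen and cannot produce both verdicts. A machine spends
  \<open>Suc depth\<close> automaton steps on one iteration; this is harmless because the variables
  keep their values during a round, so the order of the two verdicts survives. If accepting and
  rejecting variables first hold at the same iteration, the program neither accepts nor rejects, and
  the machine has to run forever. Language equality needs such care, since a word outside a language
  need not be rejected: implications for accepted and rejected words alone would not determine the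
  language. Neither construction depends on \<open>k\<close>, which enters only through the initial
  tape and the word model.\<close>

primrec esat :: "('w, 'p) kripke \<Rightarrow> ('v \<Rightarrow> 'w \<Rightarrow> bool) \<Rightarrow> 'w \<Rightarrow> ('p, 'v) fm \<Rightarrow> bool" where
  "esat M E w Top \<longleftrightarrow> True"
| "esat M E w (Prop p) \<longleftrightarrow> p \<in> label M w"
| "esat M E w (Var X) \<longleftrightarrow> E X w"
| "esat M E w (Neg f) \<longleftrightarrow> \<not> esat M E w f"
| "esat M E w (Conj f g) \<longleftrightarrow> esat M E w f \<and> esat M E w g"
| "esat M E w (Dia n f) \<longleftrightarrow> at_least n {v \<in> worlds M. (w, v) \<in> rel M \<and> esat M E v f}"
| "esat M E w (Glob n f) \<longleftrightarrow> at_least n {v \<in> worlds M. esat M E v f}"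

lemma sat_eq_esat: "sat M w f = esat M (\<lambda>_ _. False) w f"
  by (induction f arbitrary: w) simp_all

text \<open>The semantic substitution lemma. It replaces the growing formulas of
  \<open>iter_fm\<close> by a recursion on truth values, which is the form that both simulations
  use.\<close>

lemma sat_subst_vars: "sat M w (subst_vars \<sigma> f) = esat M (\<lambda>X v. sat M v (\<sigma> X)) w f"
  by (induction f arbitrary: w) simp_all

lemma esat_cong:
  "(\<And>X v. X \<in> fm_vars f \<Longrightarrow> E X v = E' X v) \<Longrightarrow> esat M E w f = esat M E' w f"
  by (induction f arbitrary: w) auto

lemma esat_map_fm: "esat M E w (map_fm id r f) = esat M (\<lambda>X. E (r X)) w f"
  by (induction f arbitrary: w) simp_all

lemma fm_vars_map_fm: "fm_vars (map_fm id r f) = r ` fm_vars f"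
  by (induction f) auto

lemma fm_props_map_fm: "fm_props (map_fm id r f) = fm_props f"
  by (induction f) auto

lemma global_free_map_fm: "global_free (map_fm id r f) = global_free f"
  by (induction f) auto

lemma ungraded_map_fm: "ungraded (map_fm id r f) = ungraded f"
  by (induction f) auto

section \<open>Truth values of the iterations of a program\<close>

definition ival :: "('p, 'v) program \<Rightarrow> ('w, 'p) kripke \<Rightarrow> nat \<Rightarrow> 'v \<Rightarrow> 'w \<Rightarrow> bool" where
  "ival \<Lambda> M n X w = sat M w (iter_fm \<Lambda> n X)"

lemma ival_0: "ival \<Lambda> M 0 X w = esat M (\<lambda>_ _. False) w (base \<Lambda> X)"
  by (simp add: ival_def sat_eq_esat)

lemma ival_Suc: "ival \<Lambda> M (Suc n) X w = esat M (ival \<Lambda> M n) w (ind \<Lambda> X)"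
  by (simp add: ival_def[abs_def] sat_subst_vars)

text \<open>With the quantifiers over variables grouped inside, acceptance is a race between two
  predicates of the iteration number, the format of \<open>first_hit_iff\<close> and
  \<open>first_hit_dilate\<close>.\<close>

lemma program_accepts_ival:
  "program_accepts \<Lambda> M w \<longleftrightarrow>
     (\<exists>n. (\<exists>X\<in>accepting \<Lambda>. ival \<Lambda> M n X w) \<and> (\<forall>m\<le>n. \<not> (\<exists>Y\<in>rejecting \<Lambda>. ival \<Lambda> M m Y w)))"
  by (auto simp: program_accepts_def ival_def)

lemma program_rejects_ival:
  "program_rejects \<Lambda> M w \<longleftrightarrow>
     (\<exists>n. (\<exists>X\<in>rejecting \<Lambda>. ival \<Lambda> M n X w) \<and> (\<forall>m\<le>n. \<not> (\<exists>Y\<in>accepting \<Lambda>. ival \<Lambda> M m Y w)))"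
  by (auto simp: program_rejects_def ival_def)

text \<open>The simulating program has variables of type \<open>sim_var\<close>, whereas the
  language classes fix \<open>nat\<close>. Injectivity on the declared variables suffices because
  the rules mention no others.\<close>

lemma rename_MSC_program:
  fixes \<Lambda> :: "('p, 'v) program" and r :: "'v \<Rightarrow> 'u"
  assumes \<Lambda>: "MSC_program P \<Lambda>" and r: "inj_on r (svars \<Lambda>)"
  obtains \<Lambda>' :: "('p, 'u) program" where "MSC_program P \<Lambda>'"
    "\<And>(M :: ('w, 'p) kripke) w. program_accepts \<Lambda>' M w = program_accepts \<Lambda> M w"
    "\<And>(M :: ('w, 'p) kripke) w. program_rejects \<Lambda>' M w = program_rejects \<Lambda> M w"
proof -
  define r' where "r' = the_inv_into (svars \<Lambda>) r"
  have r'[simp]: "r' (r X) = X" if "X \<in> svars \<Lambda>" for X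
    using that r by (simp add: r'_def the_inv_into_f_f)
  define \<Lambda>' where "\<Lambda>' = \<lparr> svars = r ` svars \<Lambda>,
    base = \<lambda>Y. map_fm id r (base \<Lambda> (r' Y)), ind = \<lambda>Y. map_fm id r (ind \<Lambda> (r' Y)),
    accepting = r ` accepting \<Lambda>, rejecting = r ` rejecting \<Lambda> \<rparr>"
  have G: "GGMSC_program P \<Lambda>"
    using \<Lambda> by (simp add: MSC_program_def GMSC_program_def)
  have acc: "accepting \<Lambda> \<subseteq> svars \<Lambda>" "rejecting \<Lambda> \<subseteq> svars \<Lambda>"
    using G by (auto simp: GGMSC_program_def)
  have disj: "r X \<noteq> r Y" if "X \<in> accepting \<Lambda>" "Y \<in> rejecting \<Lambda>" for X Y
  proof -
    have "X \<noteq> Y" using that G by (auto simp: GGMSC_program_def)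
    then show ?thesis using that acc r by (meson inj_onD subsetD)
  qed
  have iv: "ival \<Lambda>' M n (r X) w = ival \<Lambda> M n X w"
    if "X \<in> svars \<Lambda>" for n X w and M :: "('w, 'p) kripke"
    using that
  proof (induction n arbitrary: X w)
    case 0
    then show ?case by (simp add: ival_0 \<Lambda>'_def esat_map_fm)
  next
    case (Suc n)
    have "fm_vars (ind \<Lambda> X) \<subseteq> svars \<Lambda>"
      using G Suc.prems by (auto simp: GGMSC_program_def)
    then have "esat M (\<lambda>X. ival \<Lambda>' M n (r X)) w (ind \<Lambda> X) = esat M (ival \<Lambda> M n) w (ind \<Lambda> X)"
      by (intro esat_cong Suc.IH) auto
    then show ?case
      using Suc.prems by (simp add: ival_Suc \<Lambda>'_def esat_map_fm)
  qed
  have "MSC_program P \<Lambda>'"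
    using \<Lambda> disj
    by (force simp: MSC_program_def GMSC_program_def GGMSC_program_def \<Lambda>'_def fm_vars_map_fm
        fm_props_map_fm global_free_map_fm ungraded_map_fm)
  moreover have "accepting \<Lambda>' = r ` accepting \<Lambda>" "rejecting \<Lambda>' = r ` rejecting \<Lambda>"
    by (simp_all add: \<Lambda>'_def)
  moreover have "(\<exists>X\<in>r ` accepting \<Lambda>. ival \<Lambda>' M n X w) = (\<exists>X\<in>accepting \<Lambda>. ival \<Lambda> M n X w)"
    "(\<exists>X\<in>r ` rejecting \<Lambda>. ival \<Lambda>' M n X w) = (\<exists>X\<in>rejecting \<Lambda>. ival \<Lambda> M n X w)"
    for n w and M :: "('w, 'p) kripke"
    using acc iv by (auto simp: subset_eq)
  ultimately have "MSC_program P \<Lambda>'"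
    "program_accepts \<Lambda>' M w = program_accepts \<Lambda> M w"
    "program_rejects \<Lambda>' M w = program_rejects \<Lambda> M w" for w and M :: "('w, 'p) kripke"
    by (simp_all only: program_accepts_ival program_rejects_ival)
  then show ?thesis by (rule that)
qed


section \<open>Word models and runs of machines\<close>

text \<open>The link between tape symbols and node labels. \<open>Work\<close> symbols do not occur
  on an initial tape, so \<open>pb\<close> is only a default value for them.\<close>

primrec tsym_prop :: "'p \<Rightarrow> 'p \<Rightarrow> 'p \<Rightarrow> ('p, 'g) tsym \<Rightarrow> 'p" where
  "tsym_prop pb pl pr (Inp p) = p"
| "tsym_prop pb pl pr Blank = pb"
| "tsym_prop pb pl pr EndL = pl"
| "tsym_prop pb pl pr EndR = pr"
| "tsym_prop pb pl pr (Work g) = pb"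

definition input_syms :: "'p set \<Rightarrow> ('p, 'g) tsym set" where
  "input_syms A = Inp ` A \<union> {Blank, EndL, EndR}"

lemma length_init_tape [simp]: "length (init_tape k s) = length s + k + 2"
  by (simp add: init_tape_def)

lemma init_tape_nth:
  "init_tape k s ! i =
     (if i = 0 then EndL else if i \<le> length s then Inp (s ! (i - 1))
      else if i \<le> length s + k then Blank else EndR)" if "i \<le> length s + k + 1"
proof (cases i)
  case (Suc j)
  then show ?thesis using that
    by (auto simp: init_tape_def nth_append nth_Cons less_Suc_eq_le
        Suc_le_eq not_less split: nat.splits)
qed (simp add: init_tape_def)

lemma init_tape_input_syms:
  assumes "s \<in> lists A" "i \<le> length s + k + 1"
  shows "init_tape k s ! i \<in> input_syms A"
proof -
  have "s ! (i - 1) \<in> A" if "i \<noteq> 0" "i \<le> length s"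
    using assms(1) that nth_mem[of "i - 1" s] by (auto simp: in_lists_conv_set)
  then show ?thesis
    using assms(2) by (auto simp: init_tape_nth input_syms_def)
qed

text \<open>Tape and word model both start with the left marker at 0 and end with the right marker,
  so cell \<open>i\<close> and node \<open>i\<close> correspond without any shift.\<close>

lemma label_ext_word_model:
  "i \<le> length s + k + 1 \<Longrightarrow>
   label (ext_word_model pb pl pr k s) i =
     {tsym_prop pb pl pr (init_tape k s ! i :: ('p, 'g) tsym)}"
  by (auto simp: ext_word_model_def init_tape_nth)

lemma worlds_ext_word_model [simp]:
  "worlds (ext_word_model pb pl pr k s) = {..length s + k + 1}"
  by (auto simp: ext_word_model_def)

lemma rel_ext_word_model [simp]:
  "(i, j) \<in> rel (ext_word_model pb pl pr k s) \<longleftrightarrow>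
     i \<le> length s + k + 1 \<and> j \<le> length s + k + 1 \<and> (j = Suc i \<or> i = Suc j)"
  by (auto simp: ext_word_model_def)

lemma at_least_1: "at_least (Suc 0) S \<longleftrightarrow> S \<noteq> {}"
  by (cases "finite S") (auto simp: at_least_def Suc_le_eq card_gt_0_iff)

lemma esat_Diamond_ext_word_model:
  "i \<le> length s + k + 1 \<Longrightarrow>
   esat (ext_word_model pb pl pr k s) E i (Diamond f) \<longleftrightarrow>
     (\<exists>j\<le>length s + k + 1. (j = Suc i \<or> i = Suc j) \<and> esat (ext_word_model pb pl pr k s) E j f)"
  by (auto simp: at_least_1)

section \<open>Invariants of runs and renaming of machines\<close>

lemma tm_step_halted:
  "fst C \<in> tm_acc T \<union> tm_rej T \<Longrightarrow> (tm_step T ^^ n) C = C"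
  by (induction n) (cases C, auto)+

text \<open>\<open>e\<close> is the index of the last cell. The end cells must keep their markers
  because \<open>bounded_TM\<close> forbids leaving the tape only where a marker is read.\<close>

fun wf_config :: "('q, 'g, 'p) tm \<Rightarrow> nat \<Rightarrow> ('q, 'g, 'p) config \<Rightarrow> bool" where
  "wf_config T e (q, t, h) \<longleftrightarrow>
     q \<in> tm_states T \<and> set t \<subseteq> tm_symbols T \<and> length t = Suc e \<and> h \<le> e \<and>
     t ! 0 = EndL \<and> t ! e = EndR"

text \<open>Halting states receive an idle self-loop, so that \<open>tm_step\<close> becomes one
  uniform rule and the simulating program needs no case for halting.\<close>

definition eff_trans ::
    "('q, 'g, 'p) tm \<Rightarrow> 'q \<Rightarrow> ('p, 'g) tsym \<Rightarrow> 'q \<times> ('p, 'g) tsym \<times> move" where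
  "eff_trans T q a = (if q \<in> tm_acc T \<union> tm_rej T then (q, a, Stay) else tm_trans T q a)"

lemma tm_step_eff_trans:
  "tm_step T (q, t, h) =
     (case eff_trans T q (t ! h) of (q', b, d) \<Rightarrow> (q', t[h := b], move_head d h))"
  by (auto simp: eff_trans_def)

lemma eff_trans_closed:
  assumes "bounded_TM A T" "q \<in> tm_states T" "a \<in> tm_symbols T" "eff_trans T q a = (q', b, d)"
  shows "q' \<in> tm_states T" "b \<in> tm_symbols T"
    "a = EndL \<Longrightarrow> b = EndL \<and> d \<noteq> MoveL" "a = EndR \<Longrightarrow> b = EndR \<and> d \<noteq> MoveR"
proof -
  consider "q \<in> tm_acc T \<union> tm_rej T" | "q \<in> tm_states T - (tm_acc T \<union> tm_rej T)"
    using assms(2) by blast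
  then have "q' \<in> tm_states T \<and> b \<in> tm_symbols T \<and>
      (a = EndL \<longrightarrow> b = EndL \<and> d \<noteq> MoveL) \<and> (a = EndR \<longrightarrow> b = EndR \<and> d \<noteq> MoveR)"
  proof cases
    case 1
    then show ?thesis using assms by (auto simp: eff_trans_def)
  next
    case 2
    then have "tm_trans T q a = (q', b, d)"
      using assms(4) by (simp add: eff_trans_def)
    moreover have "\<forall>q \<in> tm_states T - (tm_acc T \<union> tm_rej T). \<forall>a \<in> tm_symbols T.
        case tm_trans T q a of (q', b, d) \<Rightarrow>
          q' \<in> tm_states T \<and> b \<in> tm_symbols T \<and>
          (a = EndL \<longrightarrow> b = EndL \<and> d \<noteq> MoveL) \<and>
          (a = EndR \<longrightarrow> b = EndR \<and> d \<noteq> MoveR)"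
      using assms(1) unfolding bounded_TM_def by (elim conjE)
    from bspec[OF bspec[OF this 2] assms(3)]
    have "case tm_trans T q a of (q', b, d) \<Rightarrow>
          q' \<in> tm_states T \<and> b \<in> tm_symbols T \<and>
          (a = EndL \<longrightarrow> b = EndL \<and> d \<noteq> MoveL) \<and>
          (a = EndR \<longrightarrow> b = EndR \<and> d \<noteq> MoveR)" .
    ultimately show ?thesis by simp
  qed
  then show "q' \<in> tm_states T" "b \<in> tm_symbols T"
    "a = EndL \<Longrightarrow> b = EndL \<and> d \<noteq> MoveL" "a = EndR \<Longrightarrow> b = EndR \<and> d \<noteq> MoveR"
    by blast+
qed

lemma wf_config_step:
  assumes T: "bounded_TM A T" and wf: "wf_config T e C"
  shows "wf_config T e (tm_step T C)"
proof -
  obtain q t h where C: "C = (q, t, h)" by (cases C)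
  obtain q' b d where eff: "eff_trans T q (t ! h) = (q', b, d)"
    by (cases "eff_trans T q (t ! h)")
  have a: "t ! h \<in> tm_symbols T" and q: "q \<in> tm_states T"
    using wf C nth_mem[of h t] by auto
  note cl = eff_trans_closed[OF T q a eff]
  have "set (t[h := b]) \<subseteq> tm_symbols T"
    using wf C cl(2) set_update_subset_insert[of t h b] by auto
  \<comment> \<open>Truncated subtraction keeps a left move in range, so only a right move needs the
    condition on \<open>EndR\<close>.\<close>
  moreover have "move_head d h \<le> e"
  proof (cases d)
    case MoveR
    then have "h \<noteq> e" using wf C cl(4) by auto
    then show ?thesis using wf C MoveR by simp
  qed (use wf C in auto)
  moreover have "t[h := b] ! 0 = EndL" "t[h := b] ! e = EndR"
    using wf C cl(3,4) by (simp_all add: nth_list_update)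
  ultimately show ?thesis
    using wf C cl(1) eff by (simp del: tm_step.simps add: tm_step_eff_trans)
qed

lemma wf_config_init:
  fixes T :: "('q, 'g, 'p) tm"
  assumes T: "bounded_TM A T" and s: "s \<in> lists A"
  shows "wf_config T (length s + k + 1) (init_config T k s)"
proof -
  have "set (init_tape k s) \<subseteq> tm_symbols T"
  proof
    fix a :: "('p, 'g) tsym" assume "a \<in> set (init_tape k s)"
    then have "\<exists>i<length s + k + 2. a = init_tape k s ! i"
      by (metis in_set_conv_nth length_init_tape)
    then obtain i where "i < length s + k + 2" "a = init_tape k s ! i" by blast
    then have "a \<in> input_syms A"
      using init_tape_input_syms[OF s, of i k] by (simp add: less_Suc_eq_le)
    then show "a \<in> tm_symbols T" using T by (auto simp: bounded_TM_def input_syms_def)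
  qed
  moreover have "tm_start T \<in> tm_states T" using T by (simp add: bounded_TM_def)
  ultimately show ?thesis by (simp add: init_config_def init_tape_nth)
qed

lemma wf_config_run:
  assumes "bounded_TM A T" "s \<in> lists A"
  shows "wf_config T (length s + k + 1) ((tm_step T ^^ n) (init_config T k s))"
  using wf_config_init[OF assms] by (induction n) (simp_all add: wf_config_step[OF assms(1)])

text \<open>The language classes also fix \<open>nat\<close> for states and work symbols. Only the
  contents of \<open>Work\<close> are renamed; input symbols, blank and markers stay, so initial
  tapes and the marker conditions carry over.\<close>

lemma rename_bounded_TM:
  fixes T :: "('q, 'g, 'p) tm" and f :: "'q \<Rightarrow> 'q2" and g :: "'g \<Rightarrow> 'g2"
  assumes T: "bounded_TM A T" and f: "inj_on f (tm_states T)"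
    and g: "inj_on g {x. Work x \<in> tm_symbols T}"
  obtains T' :: "('q2, 'g2, 'p) tm" where "bounded_TM A T'"
    "\<And>k s. s \<in> lists A \<Longrightarrow> tm_accepts k T' s = tm_accepts k T s"
    "\<And>k s. s \<in> lists A \<Longrightarrow> tm_rejects k T' s = tm_rejects k T s"
proof -
  define f' where "f' = the_inv_into (tm_states T) f"
  define g' where "g' = the_inv_into {x. Work x \<in> tm_symbols T} g"
  define m where "m = (map_tsym id g :: ('p, 'g) tsym \<Rightarrow> ('p, 'g2) tsym)"
  define m' where "m' = (map_tsym id g' :: ('p, 'g2) tsym \<Rightarrow> ('p, 'g) tsym)"
  have f'[simp]: "f' (f q) = q" if "q \<in> tm_states T" for q
    using that f by (simp add: f'_def the_inv_into_f_f)
  have m'[simp]: "m' (m a) = a" if "a \<in> tm_symbols T" for a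
    using that g by (cases a) (simp_all add: m_def m'_def g'_def the_inv_into_f_f)
  have m_simps[simp]: "m a = EndL \<longleftrightarrow> a = EndL" "m a = EndR \<longleftrightarrow> a = EndR"
    "m (Inp p) = Inp p" "m Blank = Blank" "m EndL = EndL" "m EndR = EndR" for a p
    by (cases a; simp add: m_def)+
  define T' where "T' = \<lparr> tm_states = f ` tm_states T, tm_symbols = m ` tm_symbols T,
     tm_start = f (tm_start T),
     tm_trans = \<lambda>q a. case tm_trans T (f' q) (m' a) of (q', b, d) \<Rightarrow> (f q', m b, d),
     tm_acc = f ` tm_acc T, tm_rej = f ` tm_rej T \<rparr>"
  have sub: "tm_acc T \<subseteq> tm_states T" "tm_rej T \<subseteq> tm_states T" "tm_acc T \<inter> tm_rej T = {}"
    using T by (auto simp: bounded_TM_def)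
  have disj: "f ` tm_acc T \<inter> f ` tm_rej T = {}"
    using f sub by (simp flip: inj_on_image_Int)
  have mem[simp]: "f q \<in> f ` tm_acc T \<longleftrightarrow> q \<in> tm_acc T" "f q \<in> f ` tm_rej T \<longleftrightarrow> q \<in> tm_rej T"
    if "q \<in> tm_states T" for q
    using that sub f by (simp_all add: inj_on_image_mem_iff)
  have "case tm_trans T' q a of (q', b, d) \<Rightarrow>
          q' \<in> tm_states T' \<and> b \<in> tm_symbols T' \<and>
          (a = EndL \<longrightarrow> b = EndL \<and> d \<noteq> MoveL) \<and> (a = EndR \<longrightarrow> b = EndR \<and> d \<noteq> MoveR)"
    if q: "q \<in> tm_states T' - (tm_acc T' \<union> tm_rej T')" and a: "a \<in> tm_symbols T'" for q a
  proof -
    obtain q0 a0 where q0: "q = f q0" "q0 \<in> tm_states T" and a0: "a = m a0" "a0 \<in> tm_symbols T"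
      using q a by (auto simp: T'_def)
    have nh: "q0 \<notin> tm_acc T \<union> tm_rej T" using q q0 by (auto simp: T'_def)
    obtain q1 b d where eff: "tm_trans T q0 a0 = (q1, b, d)" by (cases "tm_trans T q0 a0")
    have "eff_trans T q0 a0 = (q1, b, d)" using eff nh by (simp add: eff_trans_def)
    from eff_trans_closed[OF T q0(2) a0(2) this] show ?thesis
      using q0 a0 eff by (simp add: T'_def)
  qed
  moreover have "Inp ` A \<union> {Blank, EndL, EndR} \<subseteq> m ` tm_symbols T"
  proof
    fix a :: "('p, 'g2) tsym" assume a: "a \<in> Inp ` A \<union> {Blank, EndL, EndR}"
    have sub: "Inp ` A \<union> {Blank, EndL, EndR} \<subseteq> tm_symbols T"
      using T by (simp add: bounded_TM_def)
    from a have "\<exists>a0. a = m a0 \<and> a0 \<in> Inp ` A \<union> {Blank, EndL, EndR}"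
      by (auto intro: m_simps(3-6)[symmetric])
    then show "a \<in> m ` tm_symbols T" using sub by blast
  qed
  ultimately have T'b: "bounded_TM A T'"
    using T disj sub unfolding bounded_TM_def by (simp add: T'_def image_mono)
  have run: "(tm_step T' ^^ n) (init_config T' k s) =
      (case (tm_step T ^^ n) (init_config T k s) of (q, t, h) \<Rightarrow> (f q, map m t, h))"
    if s: "s \<in> lists A" for n k s
  proof (induction n)
    case 0
    show ?case by (simp add: init_config_def init_tape_def T'_def o_def)
  next
    case (Suc n)
    obtain q t h where C: "(tm_step T ^^ n) (init_config T k s) = (q, t, h)"
      by (metis prod_cases3)
    with wf_config_run[OF T s, of k n]
    have wf: "q \<in> tm_states T" "set t \<subseteq> tm_symbols T" "h < length t" by auto
    then have "t ! h \<in> tm_symbols T" by auto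
    then have "eff_trans T' (f q) (m (t ! h)) = (case eff_trans T q (t ! h) of (q', b, d) \<Rightarrow> (f q', m b, d))"
      using wf by (simp add: eff_trans_def T'_def)
    then have "tm_step T' (f q, map m t, h) =
        (case tm_step T (q, t, h) of (q, t, h) \<Rightarrow> (f q, map m t, h))"
      using wf by (simp add: tm_step_eff_trans map_update split_beta del: tm_step.simps)
    then show ?case using Suc C by (simp del: tm_step.simps)
  qed
  have fst_run: "fst ((tm_step T' ^^ n) (init_config T' k s)) =
      f (fst ((tm_step T ^^ n) (init_config T k s)))"
    and st: "fst ((tm_step T ^^ n) (init_config T k s)) \<in> tm_states T"
    if s: "s \<in> lists A" for n k s
    using run[OF s, of n k] wf_config_run[OF T s, of k n]
    by (auto split: prod.splits)
  have "tm_accepts k T' s = tm_accepts k T s" "tm_rejects k T' s = tm_rejects k T s"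
    if s: "s \<in> lists A" for k s
    by (simp_all add: tm_accepts_def tm_rejects_def fst_run[OF s] st[OF s])
      (simp_all add: T'_def st[OF s])
  with T'b show ?thesis by (rule that)
qed


section \<open>From machines to programs\<close>

text \<open>
  \<open>LeftOfHead\<close> holds at the nodes to the left of the head. It gives the symmetric word model the
  orientation that a move of the head needs, and it can be maintained locally.
\<close>

datatype ('q, 'g, 'p) sim_var =
  LeftOfHead | Accepted | Rejected | HeadIn 'q | Reads "('p, 'g) tsym"

abbreviation Bot :: "('p, 'v) fm" where
  "Bot \<equiv> Neg Top"

abbreviation Disj2 :: "('p, 'v) fm \<Rightarrow> ('p, 'v) fm \<Rightarrow> ('p, 'v) fm" where
  "Disj2 f g \<equiv> Neg (Conj (Neg f) (Neg g))"

definition Disj :: "('p, 'v) fm list \<Rightarrow> ('p, 'v) fm" where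
  "Disj fs = foldr Disj2 fs Bot"

lemma esat_Disj [simp]: "esat M E w (Disj fs) \<longleftrightarrow> (\<exists>f\<in>set fs. esat M E w f)"
  by (induction fs) (auto simp: Disj_def)

lemma fm_vars_Disj [simp]: "fm_vars (Disj fs) = (\<Union>f\<in>set fs. fm_vars f)"
  by (induction fs) (auto simp: Disj_def)

lemma fm_props_Disj [simp]: "fm_props (Disj fs) = (\<Union>f\<in>set fs. fm_props f)"
  by (induction fs) (auto simp: Disj_def)

lemma global_free_Disj [simp]: "global_free (Disj fs) \<longleftrightarrow> (\<forall>f\<in>set fs. global_free f)"
  by (induction fs) (auto simp: Disj_def)

lemma ungraded_Disj [simp]: "ungraded (Disj fs) \<longleftrightarrow> (\<forall>f\<in>set fs. ungraded f)"
  by (induction fs) (auto simp: Disj_def)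

locale tm_to_program =
  fixes A :: "'p set" and pb pl pr :: 'p and T :: "('q, 'g, 'p) tm"
    and qs :: "'q list" and as :: "('p, 'g) tsym list"
  assumes T: "bounded_TM A T"
    and qs: "set qs = tm_states T" and as: "set as = tm_symbols T"
    and marks: "pb \<notin> A" "pl \<notin> A" "pr \<notin> A" "distinct [pb, pl, pr]"
begin

text \<open>The selection by \<open>P\<close> takes place while the formula is built, so the formula
  itself contains no modality. In particular \<open>fires (\<lambda>_. True)\<close> just says that
  the head is here.\<close>

definition fires ::
    "('q \<times> ('p, 'g) tsym \<times> move \<Rightarrow> bool) \<Rightarrow> ('p, ('q, 'g, 'p) sim_var) fm" where
  "fires P = Disj [Conj (Var (HeadIn q)) (Var (Reads a)).
     (q, a) \<leftarrow> List.product qs as, P (eff_trans T q a)]"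

definition head_in :: "'q set \<Rightarrow> ('p, ('q, 'g, 'p) sim_var) fm" where
  "head_in Q = Disj [Var (HeadIn q). q \<leftarrow> qs, q \<in> Q]"

text \<open>The head starts on cell 1, the only neighbour of the node labelled \<open>pl\<close>;
  hence \<open>Diamond (Prop pl)\<close>.\<close>

primrec sim_base :: "('q, 'g, 'p) sim_var \<Rightarrow> ('p, ('q, 'g, 'p) sim_var) fm" where
  "sim_base LeftOfHead = Prop pl"
| "sim_base Accepted = Bot"
| "sim_base Rejected = Bot"
| "sim_base (HeadIn q) = (if q = tm_start T then Diamond (Prop pl) else Bot)"
| "sim_base (Reads a) = (if a \<in> input_syms A then Prop (tsym_prop pb pl pr a) else Bot)"

text \<open>With the head at \<open>h\<close>, \<open>LeftOfHead\<close> tells \<open>h - 1\<close>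
  from \<open>h + 1\<close>. A right move adds \<open>h\<close> to the nodes on the left. A left
  move removes the neighbours of \<open>h\<close>, which affects only \<open>h - 1\<close> because
  \<open>h + 1\<close> is not in the set. The verdict variables never become false again and flood
  outward from the head.\<close>

primrec sim_ind :: "('q, 'g, 'p) sim_var \<Rightarrow> ('p, ('q, 'g, 'p) sim_var) fm" where
  "sim_ind LeftOfHead = Disj2 (fires (\<lambda>(q, b, d). d = MoveR))
     (Conj (Var LeftOfHead) (Neg (Diamond (fires (\<lambda>(q, b, d). d = MoveL)))))"
| "sim_ind Accepted = Disj [Var Accepted, Diamond (Var Accepted), head_in (tm_acc T)]"
| "sim_ind Rejected = Disj [Var Rejected, Diamond (Var Rejected), head_in (tm_rej T)]"
| "sim_ind (HeadIn q') = Disj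
     [fires (\<lambda>(q, b, d). q = q' \<and> d = Stay),
      Conj (Var LeftOfHead) (Diamond (fires (\<lambda>(q, b, d). q = q' \<and> d = MoveL))),
      Conj (Neg (Var LeftOfHead)) (Diamond (fires (\<lambda>(q, b, d). q = q' \<and> d = MoveR)))]"
| "sim_ind (Reads a) = Disj2 (fires (\<lambda>(q, b, d). b = a))
     (Conj (Var (Reads a)) (Neg (fires (\<lambda>_. True))))"

definition sim_program :: "('p, ('q, 'g, 'p) sim_var) program" where
  "sim_program = \<lparr> svars = {LeftOfHead, Accepted, Rejected} \<union> HeadIn ` set qs \<union> Reads ` set as,
     base = sim_base, ind = sim_ind, accepting = {Accepted}, rejecting = {Rejected} \<rparr>"

lemma MSC_sim_program: "MSC_program (A \<union> {pb, pl, pr}) sim_program"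
proof -
  have fires: "fm_vars (fires P) \<subseteq> svars sim_program" "fm_props (fires P) = {}"
    "global_free (fires P)" "ungraded (fires P)" for P
    by (auto simp: fires_def sim_program_def)
  have head_in: "fm_vars (head_in Q) \<subseteq> svars sim_program" "fm_props (head_in Q) = {}"
    "global_free (head_in Q)" "ungraded (head_in Q)" for Q
    by (auto simp: head_in_def sim_program_def)
  have "fm_props (base sim_program X) \<subseteq> A \<union> {pb, pl, pr} \<and> fm_vars (base sim_program X) = {} \<and>
      global_free (base sim_program X) \<and> ungraded (base sim_program X)" for X
    by (cases X) (auto simp: sim_program_def input_syms_def)
  moreover have "fm_props (ind sim_program X) = {} \<and> fm_vars (ind sim_program X) \<subseteq> svars sim_program \<and>
      global_free (ind sim_program X) \<and> ungraded (ind sim_program X)" if "X \<in> svars sim_program" for X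
  proof -
    have "{LeftOfHead, Accepted, Rejected} \<subseteq> svars sim_program"
      by (simp add: sim_program_def)
    moreover have "ind sim_program X = sim_ind X" by (simp add: sim_program_def)
    ultimately show ?thesis using that by (cases X) (simp_all add: fires head_in)
  qed
  ultimately show ?thesis
    unfolding MSC_program_def GMSC_program_def GGMSC_program_def by (simp add: sim_program_def)
qed

text \<open>Freshness and distinctness of the three marks allow a node to read its initial tape
  symbol off its label.\<close>

lemma tsym_prop_inj:
  assumes "a \<in> input_syms A" "b \<in> input_syms A" "tsym_prop pb pl pr a = tsym_prop pb pl pr b"
  shows "a = b"
  using assms marks by (auto simp: input_syms_def)

section \<open>Correctness of the simulating program on a fixed word\<close>

context
  fixes s :: "'p list" and k e :: nat
  assumes s: "s \<in> lists A" and e: "e = length s + k + 1"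
begin

abbreviation M where "M \<equiv> ext_word_model pb pl pr k s"

abbreviation run :: "nat \<Rightarrow> ('q, 'g, 'p) config" where
  "run n \<equiv> (tm_step T ^^ n) (init_config T k s)"

abbreviation val where "val \<equiv> ival sim_program M"

lemma val_0: "val 0 X i = esat M (\<lambda>_ _. False) i (sim_base X)"
  by (simp add: ival_0 sim_program_def)

lemma val_Suc: "val (Suc n) X i = esat M (val n) i (sim_ind X)"
  by (simp add: ival_Suc sim_program_def)

lemma esat_Dia_M:
  "i \<le> e \<Longrightarrow> esat M E i (Dia (Suc 0) f) \<longleftrightarrow> (\<exists>j\<le>e. (j = Suc i \<or> i = Suc j) \<and> esat M E j f)"
  using esat_Diamond_ext_word_model[of i s k] by (simp add: e)

text \<open>The lockstep invariant. \<open>Accepted\<close> and \<open>Rejected\<close> are left out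
  because they lag behind the configuration; \<open>val_spread\<close> treats them.\<close>

definition tracks :: "nat \<Rightarrow> ('q, 'g, 'p) config \<Rightarrow> bool" where
  "tracks n = (\<lambda>(q, t, h). \<forall>i\<le>e.
     (val n LeftOfHead i \<longleftrightarrow> i < h) \<and>
     (\<forall>q'\<in>tm_states T. val n (HeadIn q') i \<longleftrightarrow> i = h \<and> q' = q) \<and>
     (\<forall>a\<in>tm_symbols T. val n (Reads a) i \<longleftrightarrow> a = t ! i))"

lemma tracks_0: "tracks 0 (run 0)"
proof -
  have lab: "label M i = {tsym_prop pb pl pr (init_tape k s ! i :: ('p, 'g) tsym)}"
    and inp: "(init_tape k s ! i :: ('p, 'g) tsym) \<in> input_syms A" if "i \<le> e" for i
    using that label_ext_word_model[of i s k] init_tape_input_syms[OF s, of i k] by (simp_all add: e)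
  have pl: "pl \<in> label M i \<longleftrightarrow> i = 0" if "i \<le> e" for i
    using lab[OF that] tsym_prop_inj[OF inp[OF that], of EndL] that
    by (auto simp: init_tape_nth e input_syms_def)
  have reads: "val 0 (Reads a) i \<longleftrightarrow> a = init_tape k s ! i" if "i \<le> e" for a i
    using lab[OF that] inp[OF that] tsym_prop_inj[OF inp[OF that], of a] by (auto simp: val_0)
  have "val 0 (HeadIn q) i \<longleftrightarrow> i = 1 \<and> q = tm_start T" if "i \<le> e" for q i
    using that pl e by (auto simp: val_0 esat_Dia_M simp del: esat.simps(6))
  moreover have "val 0 LeftOfHead i \<longleftrightarrow> i < 1" if "i \<le> e" for i
    using that pl by (simp add: val_0)
  ultimately show ?thesis
    using reads by (simp add: tracks_def init_config_def)
qed

lemma esat_fires: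
  assumes "tracks n (q, t, h)" "wf_config T e (q, t, h)" "i \<le> e"
  shows "esat M (val n) i (fires P) \<longleftrightarrow> i = h \<and> P (eff_trans T q (t ! h))"
proof -
  have "esat M (val n) i (fires P) \<longleftrightarrow>
      (\<exists>q'\<in>tm_states T. \<exists>a\<in>tm_symbols T.
        P (eff_trans T q' a) \<and> val n (HeadIn q') i \<and> val n (Reads a) i)"
    by (auto simp: fires_def qs as)
  also have "\<dots> \<longleftrightarrow> (\<exists>q'\<in>tm_states T. \<exists>a\<in>tm_symbols T.
        P (eff_trans T q' a) \<and> (i = h \<and> q' = q) \<and> a = t ! i)"
    using assms by (simp add: tracks_def)
  also have "\<dots> \<longleftrightarrow> i = h \<and> P (eff_trans T q (t ! h))"
    using assms nth_mem[of h t] by auto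
  finally show ?thesis .
qed

lemma tracks_Suc:
  assumes tr: "tracks n C" and wf: "wf_config T e C"
  shows "tracks (Suc n) (tm_step T C)"
proof -
  obtain q t h where C: "C = (q, t, h)" by (cases C)
  obtain q1 b d where eff: "eff_trans T q (t ! h) = (q1, b, d)"
    by (cases "eff_trans T q (t ! h)")
  have q: "q \<in> tm_states T" and a: "t ! h \<in> tm_symbols T" and h: "h \<le> e" and len: "length t = Suc e"
    using wf C nth_mem[of h t] by auto
  note cl = eff_trans_closed[OF T q a eff]
  \<comment> \<open>At \<open>h = 0\<close> truncated subtraction would keep the head in place,
    whereas \<open>sim_ind\<close> would find no node to the left and lose the head.\<close>
  have left: "d = MoveL \<Longrightarrow> h \<noteq> 0"
    using cl(3) wf C by (cases h) auto
  have step: "tm_step T C = (q1, t[h := b], move_head d h)"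
    using eff C by (simp add: tm_step_eff_trans del: tm_step.simps)
  have fires: "esat M (val n) i (fires P) \<longleftrightarrow> i = h \<and> P (q1, b, d)" if "i \<le> e" for i P
    using esat_fires[OF tr[unfolded C] wf[unfolded C] that] eff by simp
  have lft: "val n LeftOfHead i \<longleftrightarrow> i < h" if "i \<le> e" for i
    using tr that by (simp add: C tracks_def)
  have rds: "val n (Reads a) i \<longleftrightarrow> a = t ! i" if "i \<le> e" "a \<in> tm_symbols T" for i a
    using tr that by (simp add: C tracks_def)
  have "val (Suc n) LeftOfHead i \<longleftrightarrow> i < move_head d h" if "i \<le> e" for i
    using that h left by (cases d) (auto simp: val_Suc esat_Dia_M fires lft simp del: esat.simps(6))
  moreover have "val (Suc n) (HeadIn q') i \<longleftrightarrow> i = move_head d h \<and> q' = q1" if "i \<le> e" for q' i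
    using that h left by (cases d) (auto simp: val_Suc esat_Dia_M fires lft simp del: esat.simps(6))
  moreover have "val (Suc n) (Reads a) i \<longleftrightarrow> a = t[h := b] ! i"
    if "i \<le> e" "a \<in> tm_symbols T" for a i
    using that h len by (auto simp: val_Suc fires rds nth_list_update)
  ultimately show ?thesis by (simp add: tracks_def step)
qed

lemma tracks_run: "tracks n (run n)"
proof (induction n)
  case 0
  show ?case by (rule tracks_0)
next
  case (Suc n)
  then show ?case
    using tracks_Suc wf_config_run[OF T s, of k n] by (simp add: e)
qed

lemma esat_head_in:
  assumes "i \<le> e"
  shows "esat M (val n) i (head_in Q) \<longleftrightarrow> i = snd (snd (run n)) \<and> fst (run n) \<in> Q"
  using assms tracks_run[of n] wf_config_run[OF T s, of k n]
  by (cases "run n") (auto simp: head_in_def tracks_def qs)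

text \<open>A true value can always be traced back to an earlier state in \<open>Q\<close>.
  Conversely, one such state at time \<open>n\<close> suffices: \<open>d\<close> further iterations
  carry the value to all nodes within distance \<open>d\<close> of the head, and values
  persist.\<close>

lemma val_spread:
  assumes X: "\<And>i. i \<le> e \<Longrightarrow> \<not> val 0 X i"
    "sim_ind X = Disj [Var X, Diamond (Var X), head_in Q]"
  shows "(\<exists>n. val n X 1) \<longleftrightarrow> (\<exists>n. fst (run n) \<in> Q)"
proof
  have step: "val (Suc n) X i \<longleftrightarrow> val n X i \<or> (\<exists>j\<le>e. (j = Suc i \<or> i = Suc j) \<and> val n X j) \<or>
      i = snd (snd (run n)) \<and> fst (run n) \<in> Q" if "i \<le> e" for n i
    using that esat_head_in[OF that] by (simp add: val_Suc X esat_Dia_M del: esat.simps(6))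
  have "\<exists>m. fst (run m) \<in> Q" if "i \<le> e" "val n X i" for n i
    using that by (induction n arbitrary: i) (use X in \<open>auto simp: step\<close>)
  moreover have "1 \<le> e" by (simp add: e)
  ultimately show "\<exists>n. val n X 1 \<Longrightarrow> \<exists>n. fst (run n) \<in> Q" by blast
  assume "\<exists>n. fst (run n) \<in> Q"
  then obtain n where n: "fst (run n) \<in> Q" ..
  define h where "h = snd (snd (run n))"
  have h: "h \<le> e"
    using wf_config_run[OF T s, of k n] by (cases "run n") (simp add: h_def e)
  \<comment> \<open>The last two inequalities express that \<open>i\<close> and \<open>h\<close>
    differ by at most \<open>d\<close>.\<close>
  have "val (Suc n + d) X i" if "i \<le> e" "i \<le> h + d" "h \<le> i + d" for d i
    using that
  proof (induction d arbitrary: i)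
    case 0
    then show ?case using n by (simp add: step h_def)
  next
    case (Suc d)
    consider "i \<le> h + d \<and> h \<le> i + d" | "i = h + Suc d" | "h = i + Suc d"
      using Suc.prems by linarith
    then obtain j where "j \<le> e" "val (Suc n + d) X j" "i = j \<or> j = Suc i \<or> i = Suc j"
    proof cases
      case 1
      then show ?thesis using Suc that[of i] by simp
    next
      case 2
      then show ?thesis using Suc that[of "i - 1"] by simp
    next
      case 3
      then show ?thesis using Suc h that[of "Suc i"] by simp
    qed
    then have "val (Suc (Suc n + d)) X i" using step[OF Suc.prems(1)] by blast
    then show ?case by simp
  qed
  \<comment> \<open>Distance \<open>e\<close> covers the whole model, in particular node 1.\<close>
  from this[of 1 e] h show "\<exists>n. val n X 1" by (auto simp: e)
qed

text \<open>The verdict reaches node 1 with a delay, but a run never yields both verdicts, so the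
  bound on earlier iterations in \<open>program_accepts\<close> holds automatically.\<close>

lemma k_accepts_sim_program: "k_accepts pb pl pr k sim_program s \<longleftrightarrow> tm_accepts k T s"
  and k_rejects_sim_program: "k_rejects pb pl pr k sim_program s \<longleftrightarrow> tm_rejects k T s"
proof -
  have acc: "(\<exists>n. val n Accepted 1) \<longleftrightarrow> tm_accepts k T s"
    unfolding tm_accepts_def by (rule val_spread) (auto simp: val_0)
  have rej: "(\<exists>n. val n Rejected 1) \<longleftrightarrow> tm_rejects k T s"
    unfolding tm_rejects_def by (rule val_spread) (auto simp: val_0)
  have "\<not> (tm_accepts k T s \<and> tm_rejects k T s)"
  proof
    assume "tm_accepts k T s \<and> tm_rejects k T s"
    then obtain m n where m: "fst (run m) \<in> tm_acc T" and n: "fst (run n) \<in> tm_rej T"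
      by (auto simp: tm_accepts_def tm_rejects_def)
    \<comment> \<open>Both halting configurations are frozen, so they meet at time
      \<open>n + m\<close>.\<close>
    have "run (n + m) = run m" "run (m + n) = run n"
      using tm_step_halted[of "run m" T n] tm_step_halted[of "run n" T m] m n
      by (simp_all add: funpow_add)
    then have "run m = run n" by (simp add: add.commute)
    then show False using m n T by (auto simp: bounded_TM_def)
  qed
  then show "k_accepts pb pl pr k sim_program s \<longleftrightarrow> tm_accepts k T s"
    "k_rejects pb pl pr k sim_program s \<longleftrightarrow> tm_rejects k T s"
    \<comment> \<open>Only the two projections of \<open>sim_program_def\<close> are unfolded, which
      keeps \<open>sim_program\<close> folded inside \<open>ival\<close>.\<close>
    using acc rej
    by (auto simp: k_accepts_def k_rejects_def program_accepts_ival program_rejects_ival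
        sim_program_def[THEN arg_cong[where f = accepting]]
        sim_program_def[THEN arg_cong[where f = rejecting]])
qed

end

end


section \<open>Automata with a global summary, and the sweeping machine\<close>

text \<open>The left side is what a machine stopping at the first hit observes, the right side is
  the acceptance condition of programs. For the converse direction the least index with
  \<open>P\<close> is the witness.\<close>

lemma first_hit_iff:
  fixes P Q :: "nat \<Rightarrow> bool"
  shows "(\<exists>m. P m \<and> \<not> Q m \<and> (\<forall>j<m. \<not> P j \<and> \<not> Q j)) \<longleftrightarrow> (\<exists>m. P m \<and> (\<forall>j\<le>m. \<not> Q j))"
proof
  assume "\<exists>m. P m \<and> \<not> Q m \<and> (\<forall>j<m. \<not> P j \<and> \<not> Q j)"
  then show "\<exists>m. P m \<and> (\<forall>j\<le>m. \<not> Q j)" by (metis le_neq_implies_less)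
next
  assume "\<exists>m. P m \<and> (\<forall>j\<le>m. \<not> Q j)"
  then obtain m where m: "P m" "\<And>j. j \<le> m \<Longrightarrow> \<not> Q j" by blast
  then obtain m' where m': "P m'" "\<And>j. j < m' \<Longrightarrow> \<not> P j"
    using exists_least_iff[of P] by blast
  with m have "m' \<le> m" by (meson not_less)
  then show "\<exists>m. P m \<and> \<not> Q m \<and> (\<forall>j<m. \<not> P j \<and> \<not> Q j)"
    using m m' by (intro exI[of _ m']) auto
qed

text \<open>The last argument of a sweep state is the old content of the cell just left behind.
  \<open>Diverge\<close> loops and serves for ties, which must give no verdict.\<close>

datatype ('s, 'g) sweep_state =
  Check 's 's | SweepR 's 's 'g 's | SweepL 's 's 'g 's | HaltAcc | HaltRej | Diverge

text \<open>
  A synchronous cellular automaton whose cells also see a summary of the whole word, computed by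
  folding \<open>cnt\<close> over the cells; \<open>z\<close> stands for the missing neighbours of the border cells.
\<close>

locale summary_automaton =
  fixes A :: "'p set" and S :: "'s set" and G :: "'g set" and z :: 's
    and upd :: "'s \<Rightarrow> 's \<Rightarrow> 's \<Rightarrow> 'g \<Rightarrow> 's" and cnt :: "'g \<Rightarrow> 's \<Rightarrow> 'g" and g0 :: 'g
    and load :: "('p, 's \<times> 's) tsym \<Rightarrow> 's" and acc rej :: "'s \<Rightarrow> bool"
  assumes finite: "finite A" "finite S" "finite G"
    and z: "z \<in> S" and g0: "g0 \<in> G"
    and upd: "\<And>l c r g. l \<in> S \<Longrightarrow> c \<in> S \<Longrightarrow> r \<in> S \<Longrightarrow> g \<in> G \<Longrightarrow> upd l c r g \<in> S"
    and cnt: "\<And>g c. g \<in> G \<Longrightarrow> c \<in> S \<Longrightarrow> cnt g c \<in> G"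
    and load: "\<And>a. a \<in> input_syms A \<Longrightarrow> load a \<in> S"
begin

primrec summary :: "(nat \<Rightarrow> 's) \<Rightarrow> nat \<Rightarrow> 'g" where
  "summary c 0 = g0"
| "summary c (Suc n) = cnt (summary c n) (c n)"

text \<open>The word has the cells \<open>0..e\<close>.\<close>

definition step :: "nat \<Rightarrow> (nat \<Rightarrow> 's) \<Rightarrow> nat \<Rightarrow> 's" where
  "step e c i = upd (if i = 0 then z else c (i - 1)) (c i) (if i < e then c (Suc i) else z)
     (summary c (Suc e))"

text \<open>Before the first sweep the interior still holds input symbols, whose contents
  \<open>load\<close> supplies; afterwards every interior cell is a \<open>Work\<close>
  pair.\<close>

fun content :: "('p, 's \<times> 's) tsym \<Rightarrow> 's" where
  "content (Work (l, c)) = c"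
| "content a = load a"

fun left_copy :: "('p, 's \<times> 's) tsym \<Rightarrow> 's" where
  "left_copy (Work (l, c)) = l"
| "left_copy a = z"

text \<open>
  The end markers cannot be overwritten, so the contents \<open>x\<close>, \<open>y\<close> of the two border cells live in
  the state. The sweep to the right computes the summary \<open>g\<close> and leaves in each cell a copy of its
  left neighbour, which is what the sweep to the left needs for updating in place.
\<close>

fun trans :: "('s, 'g) sweep_state \<Rightarrow> ('p, 's \<times> 's) tsym \<Rightarrow>
    ('s, 'g) sweep_state \<times> ('p, 's \<times> 's) tsym \<times> move" where
  "trans (Check x y) a =
     (let c = (if a = EndR then y else content a) in
      (if a = EndL \<or> acc c \<and> rej c then Diverge else if acc c then HaltAcc
       else if rej c then HaltRej else SweepR x y (cnt g0 x) x, a, Stay))"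
| "trans (SweepR x y g l) a =
     (if a = EndL then (Diverge, a, Stay)
      else if a = EndR then (SweepL x (upd l y z (cnt g y)) (cnt g y) y, a, MoveL)
      else (SweepR x y (cnt g (content a)) (content a), Work (l, content a), MoveR))"
| "trans (SweepL x y g r) a =
     (if a = EndL then (Check (upd z x r g) y, a, MoveR)
      else if a = EndR then (Diverge, a, Stay)
      else (SweepL x y g (content a), Work (z, upd (left_copy a) (content a) r g), MoveL))"
| "trans q a = (Diverge, a, Stay)"

definition TM :: "(('s, 'g) sweep_state, 's \<times> 's, 'p) tm" where
  "TM = \<lparr> tm_states = (\<lambda>(x, y). Check x y) ` (S \<times> S) \<union>
       (\<lambda>(x, y, g, l). SweepR x y g l) ` (S \<times> S \<times> G \<times> S) \<union>
       (\<lambda>(x, y, g, r). SweepL x y g r) ` (S \<times> S \<times> G \<times> S) \<union> {HaltAcc, HaltRej, Diverge},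
     tm_symbols = input_syms A \<union> Work ` (S \<times> S),
     tm_start = Check (load EndL) (load EndR), tm_trans = trans,
     tm_acc = {HaltAcc}, tm_rej = {HaltRej} \<rparr>"

lemma TM_simps [simp]:
  "tm_start TM = Check (load EndL) (load EndR)" "tm_trans TM = trans"
  "tm_acc TM = {HaltAcc}" "tm_rej TM = {HaltRej}"
  by (simp_all add: TM_def)

lemma states_iff [simp]:
  "Check x y \<in> tm_states TM \<longleftrightarrow> x \<in> S \<and> y \<in> S"
  "SweepR x y g l \<in> tm_states TM \<longleftrightarrow> x \<in> S \<and> y \<in> S \<and> g \<in> G \<and> l \<in> S"
  "SweepL x y g l \<in> tm_states TM \<longleftrightarrow> x \<in> S \<and> y \<in> S \<and> g \<in> G \<and> l \<in> S"
  "HaltAcc \<in> tm_states TM" "HaltRej \<in> tm_states TM" "Diverge \<in> tm_states TM"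
  by (auto simp: TM_def image_iff Bex_def split_paired_Ex)

lemma symbols_content:
  assumes "a \<in> tm_symbols TM"
  shows "content a \<in> S" "left_copy a \<in> S"
  using assms load z by (auto simp: TM_def input_syms_def)

lemma bounded_TM: "bounded_TM A TM"
proof -
  have W: "Work (l, c) \<in> tm_symbols TM" if "l \<in> S" "c \<in> S" for l c
    using that by (simp add: TM_def)
  have E: "load EndL \<in> S" "load EndR \<in> S" by (simp_all add: load input_syms_def)
  have "case trans q a of (q', b, d) \<Rightarrow>
      q' \<in> tm_states TM \<and> b \<in> tm_symbols TM \<and>
      (a = EndL \<longrightarrow> b = EndL \<and> d \<noteq> MoveL) \<and> (a = EndR \<longrightarrow> b = EndR \<and> d \<noteq> MoveR)"
    if "q \<in> tm_states TM" "a \<in> tm_symbols TM" for q a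
    using that symbols_content[OF that(2)]
    by (cases q) (auto simp: Let_def upd cnt z g0 W)
  moreover have "finite (tm_states TM)" "finite (tm_symbols TM)"
    "Inp ` A \<union> {Blank, EndL, EndR} \<subseteq> tm_symbols TM"
    using finite by (auto simp: TM_def input_syms_def)
  ultimately show ?thesis
    unfolding bounded_TM_def by (simp add: E)
qed

section \<open>One automaton step as a sweep to the right and back\<close>

definition reaches (infix "\<leadsto>" 50) where
  "C \<leadsto> D \<longleftrightarrow> (\<exists>n. (tm_step TM ^^ n) C = D)"

lemma reaches_trans [trans]: "B \<leadsto> C \<Longrightarrow> C \<leadsto> D \<Longrightarrow> B \<leadsto> D"
  unfolding reaches_def by (metis funpow_add comp_apply)

lemma reaches_refl: "C \<leadsto> C"
  unfolding reaches_def by (rule exI[of _ 0]) simp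

lemma reaches_step: "tm_step TM C = D \<Longrightarrow> C \<leadsto> D"
  unfolding reaches_def by (rule exI[of _ 1]) simp

text \<open>Stronger than the tape condition of \<open>wf_config\<close>: markers are excluded from
  the interior, since the sweeps recognize the ends of the tape by them.\<close>

definition framed :: "nat \<Rightarrow> ('p, 's \<times> 's) tsym list \<Rightarrow> bool" where
  "framed e t \<longleftrightarrow> length t = Suc e \<and> t ! 0 = EndL \<and> t ! e = EndR \<and>
     (\<forall>j. 0 < j \<and> j < e \<longrightarrow> t ! j \<noteq> EndL \<and> t ! j \<noteq> EndR)"

definition holds :: "nat \<Rightarrow> (nat \<Rightarrow> 's) \<Rightarrow> ('p, 's \<times> 's) tsym list \<Rightarrow> bool" where
  "holds e c t \<longleftrightarrow> framed e t \<and> (\<forall>j. 0 < j \<and> j < e \<longrightarrow> content (t ! j) = c j)"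

text \<open>The sweep starts at cell 1 with cell 0 already counted, because \<open>Check\<close> has
  absorbed the left border from the state. Contents are preserved and only left copies are
  added.\<close>

lemma sweep_right:
  assumes "1 \<le> i" "i \<le> e" and t: "holds e c t"
  shows "\<exists>t'. (SweepR x y (summary c 1) (c 0), t, 1) \<leadsto> (SweepR x y (summary c i) (c (i - 1)), t', i) \<and>
    holds e c t' \<and> (\<forall>j. 0 < j \<and> j < i \<longrightarrow> left_copy (t' ! j) = c (j - 1))"
  using assms(1,2)
proof (induction i rule: nat_induct_at_least)
  case base
  show ?case
  proof (intro exI conjI)
    show "(SweepR x y (summary c 1) (c 0), t, 1) \<leadsto> (SweepR x y (summary c 1) (c (1 - 1)), t, 1)"
      by (simp add: reaches_refl)
  qed (use t in auto)
next
  case (Suc i)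
  then obtain t' where
    r: "(SweepR x y (summary c 1) (c 0), t, 1) \<leadsto> (SweepR x y (summary c i) (c (i - 1)), t', i)" and
    t': "holds e c t'" and l: "\<And>j. 0 < j \<Longrightarrow> j < i \<Longrightarrow> left_copy (t' ! j) = c (j - 1)"
    by auto
  have i: "t' ! i \<noteq> EndL" "t' ! i \<noteq> EndR" "content (t' ! i) = c i" "i < length t'"
    using t' Suc by (simp_all add: holds_def framed_def)
  note r
  also have "(SweepR x y (summary c i) (c (i - 1)), t', i) \<leadsto>
      (SweepR x y (summary c (Suc i)) (c i), t'[i := Work (c (i - 1), c i)], Suc i)"
    by (rule reaches_step) (simp add: i)
  finally have "(SweepR x y (summary c 1) (c 0), t, 1) \<leadsto>
      (SweepR x y (summary c (Suc i)) (c i), t'[i := Work (c (i - 1), c i)], Suc i)" .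
  moreover have "holds e c (t'[i := Work (c (i - 1), c i)])"
    using t' Suc.hyps Suc.prems by (auto simp: holds_def framed_def nth_list_update)
  moreover have "left_copy (t'[i := Work (c (i - 1), c i)] ! j) = c (j - 1)"
    if "0 < j" "j < Suc i" for j
    using that l i(4) by (cases "j = i") auto
  ultimately show ?case unfolding diff_Suc_1 by blast
qed

text \<open>\<open>d\<close> counts the updated cells. Updating in place works because the old right
  neighbour is carried in the state and the old left neighbour is the stored copy, so nothing needed
  later is lost.\<close>

lemma sweep_left:
  assumes "d < e" and t: "holds e c t"
    and l: "\<And>j. 0 < j \<Longrightarrow> j < e \<Longrightarrow> left_copy (t ! j) = c (j - 1)"
  shows "\<exists>t'. (SweepL x y (summary c (Suc e)) (c e), t, e - 1) \<leadsto>
      (SweepL x y (summary c (Suc e)) (c (e - d)), t', e - 1 - d) \<and> framed e t' \<and>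
    (\<forall>j. 0 < j \<and> j < e - d \<longrightarrow> t' ! j = t ! j) \<and>
    (\<forall>j. e - d \<le> j \<and> j < e \<longrightarrow> content (t' ! j) = step e c j)"
  using assms(1)
proof (induction d)
  case 0
  have "(SweepL x y (summary c (Suc e)) (c e), t, e - 1) \<leadsto>
      (SweepL x y (summary c (Suc e)) (c (e - 0)), t, e - 1 - 0)"
    by (simp add: reaches_refl)
  then show ?case using t by (intro exI[of _ t]) (auto simp: holds_def)
next
  case (Suc d)
  let ?g = "summary c (Suc e)"
  define i where "i = e - 1 - d"
  have i: "0 < i" "i < e" "e - d = Suc i" "e - Suc d = i" "e - 1 - Suc d = i - 1"
    using Suc.prems by (auto simp: i_def)
  have "d < e" using Suc.prems by simp
  from Suc.IH[OF this, unfolded i(3), folded i_def] obtain t' where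
    r: "(SweepL x y ?g (c e), t, e - 1) \<leadsto> (SweepL x y ?g (c (Suc i)), t', i)"
    and fr: "framed e t'" and old: "\<And>j. 0 < j \<Longrightarrow> j \<le> i \<Longrightarrow> t' ! j = t ! j"
    and new: "\<And>j. i < j \<Longrightarrow> j < e \<Longrightarrow> content (t' ! j) = step e c j"
    by (metis Suc_leI le_imp_less_Suc)
  have ti: "t' ! i = t ! i" "t ! i \<noteq> EndL" "t ! i \<noteq> EndR" "content (t ! i) = c i"
    "left_copy (t ! i) = c (i - 1)" "i < length t'"
    using old[of i] i t l fr by (simp_all add: holds_def framed_def)
  \<comment> \<open>\<open>z\<close> is a placeholder for the left copy; the next sweep to the right
    overwrites it.\<close>
  let ?t = "t'[i := Work (z, step e c i)]"
  note r
  also have "(SweepL x y ?g (c (Suc i)), t', i) \<leadsto> (SweepL x y ?g (c i), ?t, i - 1)"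
    by (rule reaches_step) (use ti i in \<open>simp add: step_def\<close>)
  finally have "(SweepL x y ?g (c e), t, e - 1) \<leadsto> (SweepL x y ?g (c i), ?t, i - 1)" .
  moreover have "framed e ?t" "\<forall>j. 0 < j \<and> j < i \<longrightarrow> ?t ! j = t ! j"
    "\<forall>j. i \<le> j \<and> j < e \<longrightarrow> content (?t ! j) = step e c j"
    using fr old new ti i by (auto simp: framed_def nth_list_update)
  ultimately show ?case unfolding i(4,5) by blast
qed

text \<open>The right border is updated at the turn, as soon as the summary is complete, and the
  left border last, when its old right neighbour arrives in the state.\<close>

lemma full_sweep:
  assumes e: "1 \<le> e" and t: "holds e c t"
  shows "\<exists>t'. (SweepR (c 0) (c e) (summary c 1) (c 0), t, 1) \<leadsto>
      (Check (step e c 0) (step e c e), t', 1) \<and> holds e (step e c) t'"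
proof -
  let ?g = "summary c (Suc e)"
  from sweep_right[OF e order_refl t] obtain t1 where
    r1: "(SweepR (c 0) (c e) (summary c 1) (c 0), t, 1) \<leadsto>
      (SweepR (c 0) (c e) (summary c e) (c (e - 1)), t1, e)"
    and t1: "holds e c t1" and l1: "\<And>j. 0 < j \<Longrightarrow> j < e \<Longrightarrow> left_copy (t1 ! j) = c (j - 1)"
    by blast
  have "t1 ! e = EndR" "t1[e := EndR] = t1"
    using t1 list_update_id[of t1 e] by (auto simp: holds_def framed_def)
  then have r2: "(SweepR (c 0) (c e) (summary c e) (c (e - 1)), t1, e) \<leadsto>
      (SweepL (c 0) (step e c e) ?g (c e), t1, e - 1)"
    using e by (intro reaches_step) (simp add: step_def)
  from sweep_left[OF _ t1 l1, of "e - 1" "c 0" "step e c e"] e obtain t2 where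
    r3: "(SweepL (c 0) (step e c e) ?g (c e), t1, e - 1) \<leadsto>
      (SweepL (c 0) (step e c e) ?g (c 1), t2, 0)"
    and t2: "framed e t2" and new: "\<And>j. 0 < j \<Longrightarrow> j < e \<Longrightarrow> content (t2 ! j) = step e c j"
    by (auto simp: Suc_le_eq simp del: summary.simps)
  have "t2 ! 0 = EndL" "t2[0 := EndL] = t2"
    using t2 list_update_id[of t2 0] by (auto simp: framed_def)
  then have r4: "(SweepL (c 0) (step e c e) ?g (c 1), t2, 0) \<leadsto>
      (Check (step e c 0) (step e c e), t2, 1)"
    using e by (intro reaches_step) (simp add: step_def)
  note r1 also note r2 also note r3 also note r4
  finally show ?thesis using t2 new by (auto simp: holds_def)
qed

text \<open>Applied where \<open>acc c\<close> or \<open>rej c\<close> holds, so the last branch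
  stands for rejection alone.\<close>

definition final_state :: "'s \<Rightarrow> ('s, 'g) sweep_state" where
  "final_state c = (if acc c \<and> rej c then Diverge else if acc c then HaltAcc else HaltRej)"

lemma final_state_HaltAcc: "(acc c \<or> rej c) \<and> final_state c = HaltAcc \<longleftrightarrow> acc c \<and> \<not> rej c"
  and final_state_HaltRej: "(acc c \<or> rej c) \<and> final_state c = HaltRej \<longleftrightarrow> rej c \<and> \<not> acc c"
  by (auto simp: final_state_def)

lemma check_step:
  assumes "1 \<le> e" "holds e c t"
  shows "tm_step TM (Check (c 0) (c e), t, 1) =
    (if acc (c 1) \<or> rej (c 1) then final_state (c 1)
     else SweepR (c 0) (c e) (summary c 1) (c 0), t, 1)"
proof -
  \<comment> \<open>If \<open>e = 1\<close>, as for the empty word without padding, cell 1 is the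
    right border and its content is in the state.\<close>
  have 1: "t ! 1 \<noteq> EndL" "(if t ! 1 = EndR then c e else content (t ! 1)) = c 1"
    using assms by (cases "e = 1"; auto simp: holds_def framed_def)+
  have "trans (Check (c 0) (c e)) (t ! 1) =
      (if acc (c 1) \<or> rej (c 1) then final_state (c 1)
       else SweepR (c 0) (c e) (summary c 1) (c 0), t ! 1, Stay)"
    unfolding trans.simps 1(2) using 1(1) by (simp add: Let_def final_state_def)
  then show ?thesis by simp
qed

lemma halted_run:
  assumes "q \<in> {HaltAcc, HaltRej, Diverge}"
  shows "(tm_step TM ^^ n) (q, t, h) = (q, t, h)"
  using assms by (induction n) auto

section \<open>Outcome of the sweeping machine on a fixed word\<close>

context
  fixes s :: "'p list" and k e :: nat
  assumes s: "s \<in> lists A" and e: "e = length s + k + 1"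
begin

definition cells :: "nat \<Rightarrow> nat \<Rightarrow> 's" where
  "cells m = (step e ^^ m) (\<lambda>i. load (init_tape k s ! i))"

abbreviation run where "run n \<equiv> (tm_step TM ^^ n) (init_config TM k s)"

text \<open>The bound \<open>m \<le> n\<close> is there for nontermination: if no cell value ever
  gives a verdict, the machine is in a \<open>Check\<close> state at arbitrarily late times and
  hence never halts.\<close>

lemma run_at_check:
  assumes "\<And>j. j < m \<Longrightarrow> \<not> acc (cells j 1) \<and> \<not> rej (cells j 1)"
  shows "\<exists>n t. m \<le> n \<and> run n = (Check (cells m 0) (cells m e), t, 1) \<and> holds e (cells m) t"
  using assms
proof (induction m)
  case 0
  have c0: "cells 0 = (\<lambda>i. load (init_tape k s ! i))"
    by (simp add: cells_def)
  have "holds e (cells 0) (init_tape k s)"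
    unfolding c0 by (auto simp: holds_def framed_def init_tape_nth e)
  moreover have "run 0 = (Check (cells 0 0) (cells 0 e), init_tape k s, 1)"
    unfolding c0 by (simp add: init_config_def init_tape_nth e)
  ultimately show ?case by blast
next
  case (Suc m)
  then obtain n t where n: "m \<le> n" "run n = (Check (cells m 0) (cells m e), t, 1)"
    and t: "holds e (cells m) t"
    by (metis less_SucI)
  have e1: "1 \<le> e" by (simp add: e)
  have sw: "run (Suc n) = (SweepR (cells m 0) (cells m e) (summary (cells m) 1) (cells m 0), t, 1)"
    using n(2) check_step[OF e1 t] Suc.prems[of m] by (simp del: summary.simps tm_step.simps)
  from full_sweep[OF e1 t] obtain t' n' where
    "(tm_step TM ^^ n') (run (Suc n)) = (Check (cells (Suc m) 0) (cells (Suc m) e), t', 1)"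
    "holds e (cells (Suc m)) t'"
    unfolding sw reaches_def by (auto simp: cells_def)
  then have "run (n' + Suc n) = (Check (cells (Suc m) 0) (cells (Suc m) e), t', 1)"
    "holds e (cells (Suc m)) t'"
    by (simp_all only: funpow_add o_apply)
  then show ?case using n(1) by (intro exI[of _ "n' + Suc n"]) auto
qed

text \<open>The first verdict leads to a frozen configuration, and so does the given halt; by
  determinism the two agree at a common later time.\<close>

lemma run_final:
  assumes "acc (cells m 1) \<or> rej (cells m 1)"
    and "\<And>j. j < m \<Longrightarrow> \<not> acc (cells j 1) \<and> \<not> rej (cells j 1)"
    and q: "fst (run n) \<in> {HaltAcc, HaltRej, Diverge}"
  shows "fst (run n) = final_state (cells m 1)"
proof -
  obtain n' t where n': "run n' = (Check (cells m 0) (cells m e), t, 1)" "holds e (cells m) t"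
    using run_at_check[OF assms(2)] by blast
  then have 1: "run (Suc n') = (final_state (cells m 1), t, 1)"
    using check_step[of e "cells m" t] assms(1) by (simp add: e del: tm_step.simps)
  have "final_state (cells m 1) \<in> {HaltAcc, HaltRej, Diverge}" by (simp add: final_state_def)
  from halted_run[OF this, of n t 1] have "run (n + Suc n') = (final_state (cells m 1), t, 1)"
    unfolding 1[symmetric] by (simp only: funpow_add o_apply)
  moreover have "run (Suc n' + n) = run n"
    using halted_run[OF q, of "Suc n'" "fst (snd (run n))" "snd (snd (run n))"]
    by (simp only: funpow_add o_apply prod.collapse)
  ultimately show ?thesis by (metis add.commute fst_conv)
qed

lemma run_reaches_final:
  assumes "acc (cells m 1) \<or> rej (cells m 1)"
    and "\<And>j. j < m \<Longrightarrow> \<not> acc (cells j 1) \<and> \<not> rej (cells j 1)"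
  shows "\<exists>n. fst (run n) = final_state (cells m 1)"
proof -
  obtain n t where "run n = (Check (cells m 0) (cells m e), t, 1)" "holds e (cells m) t"
    using run_at_check[OF assms(2)] by blast
  then have "run (Suc n) = (final_state (cells m 1), t, 1)"
    using check_step[of e "cells m" t] assms(1) by (simp add: e del: tm_step.simps)
  then show ?thesis by (metis fst_conv)
qed

lemma run_final_iff:
  assumes q: "q \<in> {HaltAcc, HaltRej}"
  shows "(\<exists>n. fst (run n) = q) \<longleftrightarrow>
    (\<exists>m. (acc (cells m 1) \<or> rej (cells m 1)) \<and> final_state (cells m 1) = q \<and>
       (\<forall>j<m. \<not> acc (cells j 1) \<and> \<not> rej (cells j 1)))"
proof
  assume "\<exists>n. fst (run n) = q"
  then obtain n where n: "fst (run n) = q" ..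
  show "\<exists>m. (acc (cells m 1) \<or> rej (cells m 1)) \<and> final_state (cells m 1) = q \<and>
       (\<forall>j<m. \<not> acc (cells j 1) \<and> \<not> rej (cells j 1))"
  proof (cases "\<exists>m. acc (cells m 1) \<or> rej (cells m 1)")
    case True
    then obtain m where m: "acc (cells m 1) \<or> rej (cells m 1)"
      "\<And>j. j < m \<Longrightarrow> \<not> acc (cells j 1) \<and> \<not> rej (cells j 1)"
      using exists_least_iff[of "\<lambda>m. acc (cells m 1) \<or> rej (cells m 1)"] by blast
    from run_final[OF m, of n] n q have "final_state (cells m 1) = q" by auto
    then show ?thesis using m by blast
  next
    case False
    then obtain n' t where n': "n \<le> n'" "run n' = (Check (cells n 0) (cells n e), t, 1)"
      using run_at_check[of n] by blast
    have "fst (run n) \<in> {HaltAcc, HaltRej, Diverge}" using n q by auto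
    from halted_run[OF this, of "n' - n" "fst (snd (run n))" "snd (snd (run n))"]
    have "run (n' - n + n) = run n"
      by (simp only: funpow_add o_apply prod.collapse)
    then have "fst (run n) = Check (cells n 0) (cells n e)"
      using n' by (metis fst_conv le_add_diff_inverse2)
    then show ?thesis using n q by auto
  qed
qed (use run_reaches_final in blast)

lemma tm_accepts_TM:
  "tm_accepts k TM s \<longleftrightarrow> (\<exists>m. acc (cells m 1) \<and> (\<forall>j\<le>m. \<not> rej (cells j 1)))"
proof -
  have "tm_accepts k TM s \<longleftrightarrow> (\<exists>n. fst (run n) = HaltAcc)" by (simp add: tm_accepts_def)
  also have "\<dots> \<longleftrightarrow> (\<exists>m. acc (cells m 1) \<and> \<not> rej (cells m 1) \<and>
      (\<forall>j<m. \<not> acc (cells j 1) \<and> \<not> rej (cells j 1)))"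
    by (simp only: run_final_iff insert_iff simp_thms final_state_HaltAcc flip: conj_assoc)
  finally show ?thesis unfolding first_hit_iff[of "\<lambda>m. acc (cells m 1)" "\<lambda>m. rej (cells m 1)"] .
qed

lemma tm_rejects_TM:
  "tm_rejects k TM s \<longleftrightarrow> (\<exists>m. rej (cells m 1) \<and> (\<forall>j\<le>m. \<not> acc (cells j 1)))"
proof -
  have "tm_rejects k TM s \<longleftrightarrow> (\<exists>n. fst (run n) = HaltRej)" by (simp add: tm_rejects_def)
  also have "\<dots> \<longleftrightarrow> (\<exists>m. rej (cells m 1) \<and> \<not> acc (cells m 1) \<and>
      (\<forall>j<m. \<not> acc (cells j 1) \<and> \<not> rej (cells j 1)))"
    by (simp only: run_final_iff insert_iff simp_thms final_state_HaltRej flip: conj_assoc)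
  also have "\<dots> \<longleftrightarrow> (\<exists>m. rej (cells m 1) \<and> \<not> acc (cells m 1) \<and>
      (\<forall>j<m. \<not> rej (cells j 1) \<and> \<not> acc (cells j 1)))"
    by (simp only: conj_commute)
  finally show ?thesis unfolding first_hit_iff[of "\<lambda>m. rej (cells m 1)" "\<lambda>m. acc (cells m 1)"] .
qed

end

end


section \<open>From programs to machines\<close>

primrec subfms :: "('p, 'v) fm \<Rightarrow> ('p, 'v) fm set" where
  "subfms Top = {Top}"
| "subfms (Prop p) = {Prop p}"
| "subfms (Var X) = {Var X}"
| "subfms (Neg f) = insert (Neg f) (subfms f)"
| "subfms (Conj f g) = insert (Conj f g) (subfms f \<union> subfms g)"
| "subfms (Dia n f) = insert (Dia n f) (subfms f)"
| "subfms (Glob n f) = insert (Glob n f) (subfms f)"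

lemma finite_subfms: "finite (subfms f)"
  by (induction f) auto

lemma subfms_refl: "f \<in> subfms f"
  by (cases f) auto

lemma subfms_trans: "g \<in> subfms f \<Longrightarrow> subfms g \<subseteq> subfms f"
  by (induction f) auto

lemma Var_subfms: "Var X \<in> subfms f \<Longrightarrow> X \<in> fm_vars f"
  by (induction f) auto

text \<open>Only the outermost operator is inspected. The maximum is later taken over
  \<open>FL\<close>, which is closed under subformulas, so nested grades are covered.\<close>

primrec glob_grade :: "('p, 'v) fm \<Rightarrow> nat" where
  "glob_grade Top = 0"
| "glob_grade (Prop p) = 0"
| "glob_grade (Var X) = 0"
| "glob_grade (Neg f) = 0"
| "glob_grade (Conj f g) = 0"
| "glob_grade (Dia n f) = 0"
| "glob_grade (Glob n f) = n"

text \<open>One level of the semantics, given the formulas true at the left neighbour, at the node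
  and at the right neighbour, and the global counts. Atoms are copied from \<open>T\<close> because
  they do not change within a round. A node has at most two neighbours, so two indicators count them
  exactly.\<close>

primrec level_sat :: "('p, 'v) fm set \<Rightarrow> ('p, 'v) fm set \<Rightarrow> ('p, 'v) fm set \<Rightarrow>
    (('p, 'v) fm \<Rightarrow> nat) \<Rightarrow> ('p, 'v) fm \<Rightarrow> bool" where
  "level_sat L T R g Top \<longleftrightarrow> True"
| "level_sat L T R g (Prop p) \<longleftrightarrow> Prop p \<in> T"
| "level_sat L T R g (Var X) \<longleftrightarrow> Var X \<in> T"
| "level_sat L T R g (Neg f) \<longleftrightarrow> f \<notin> T"
| "level_sat L T R g (Conj f f') \<longleftrightarrow> f \<in> T \<and> f' \<in> T"
| "level_sat L T R g (Dia n f) \<longleftrightarrow> n \<le> of_bool (f \<in> L) + of_bool (f \<in> R)"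
| "level_sat L T R g (Glob n f) \<longleftrightarrow> n \<le> g f"

lemma at_least_neighbours:
  assumes "i \<le> length s + k + 1"
  shows "at_least n {v \<in> worlds (ext_word_model pb pl pr k s).
      (i, v) \<in> rel (ext_word_model pb pl pr k s) \<and> P v} \<longleftrightarrow>
    n \<le> of_bool (0 < i \<and> P (i - 1)) + of_bool (i < length s + k + 1 \<and> P (Suc i))"
proof -
  have "{v \<in> worlds (ext_word_model pb pl pr k s). (i, v) \<in> rel (ext_word_model pb pl pr k s) \<and> P v}
    = (if 0 < i \<and> P (i - 1) then {i - 1} else {}) \<union>
      (if i < length s + k + 1 \<and> P (Suc i) then {Suc i} else {})"
    using assms by auto
  then show ?thesis by (simp add: at_least_def)
qed

text \<open>Slowing both predicates down by the factor \<open>d\<close> makes them constant on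
  blocks of length \<open>d\<close>, which preserves the order of their hits. Index 0 stands for the
  time before any iteration has been computed.\<close>

lemma first_hit_dilate:
  fixes a b :: "nat \<Rightarrow> bool"
  assumes "0 < d" "\<not> a 0" "\<not> b 0"
  shows "(\<exists>m. a (m div d) \<and> (\<forall>j\<le>m. \<not> b (j div d))) \<longleftrightarrow>
    (\<exists>n. a (Suc n) \<and> (\<forall>j\<le>n. \<not> b (Suc j)))"
proof
  assume "\<exists>m. a (m div d) \<and> (\<forall>j\<le>m. \<not> b (j div d))"
  then obtain m where m: "a (m div d)" "\<And>j. j \<le> m \<Longrightarrow> \<not> b (j div d)" by blast
  then obtain n where n: "m div d = Suc n" using assms(2) by (metis not0_implies_Suc)
  have "\<not> b (Suc j)" if "j \<le> n" for j
  proof -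
    have "Suc j \<le> m div d" using that n by simp
    then have "Suc j * d \<le> m"
      using assms(1) by (simp add: less_eq_div_iff_mult_less_eq)
    with m(2)[of "Suc j * d"] assms(1) show ?thesis by (simp del: mult_Suc)
  qed
  then show "\<exists>n. a (Suc n) \<and> (\<forall>j\<le>n. \<not> b (Suc j))" using m n by auto
next
  assume "\<exists>n. a (Suc n) \<and> (\<forall>j\<le>n. \<not> b (Suc j))"
  then obtain n where n: "a (Suc n)" "\<And>j. j \<le> n \<Longrightarrow> \<not> b (Suc j)" by blast
  have "\<not> b (j div d)" if "j \<le> Suc n * d" for j
  proof -
    have "j div d \<le> Suc n"
      using div_le_mono[OF that, of d] assms(1) by (simp del: mult_Suc)
    then show ?thesis using n(2) assms(3) by (cases "j div d") auto
  qed
  \<comment> \<open>The witness \<open>Suc n * d\<close> is the first step of block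
    \<open>Suc n\<close>.\<close>
  then show "\<exists>m. a (m div d) \<and> (\<forall>j\<le>m. \<not> b (j div d))"
    using n(1) assms(1) by (intro exI[of _ "Suc n * d"]) (simp del: mult_Suc)
qed

text \<open>
  A cell is a triple \<open>(b, j, T)\<close>. After \<open>j\<close> steps of a round, \<open>T\<close> is correct for the formulas of
  size below \<open>j\<close>, relative to the values of the schema variables that were fixed at the start of
  the round. After \<open>depth\<close> steps the rules have been evaluated, and the next step starts a new
  round with new values of the variables. The flag \<open>b\<close> is false in the first round, which
  evaluates the base rules.
\<close>

locale program_to_tm =
  fixes A :: "'p set" and pb pl pr :: 'p and \<Lambda> :: "('p, 'v) program"
  assumes finite_A: "finite A" and \<Lambda>: "GGMSC_program (A \<union> {pb, pl, pr}) \<Lambda>"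
begin

text \<open>A closure in the style of Fischer and Ladner. All propositions and variables are
  included, even those that no rule mentions, because a cell stores its label and its variable
  values as members of a subset of \<open>FL\<close>.\<close>

definition FL :: "('p, 'v) fm set" where
  "FL = Prop ` (A \<union> {pb, pl, pr}) \<union> Var ` svars \<Lambda> \<union>
     (\<Union>X\<in>svars \<Lambda>. subfms (base \<Lambda> X) \<union> subfms (ind \<Lambda> X))"

text \<open>After \<open>j\<close> steps of a round the formulas of size below \<open>j\<close> are
  settled; the successor makes \<open>depth\<close> steps enough for all of
  \<open>FL\<close>.\<close>

definition depth :: nat where
  "depth = Suc (Max (size ` FL))"

text \<open>Truncation at this bound keeps the set of summaries finite, and no threshold
  \<open>n\<close> of a formula \<open>Glob n f\<close> in \<open>FL\<close> exceeds it.\<close>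

definition max_grade :: nat where
  "max_grade = Max (glob_grade ` FL)"

lemma finite_FL: "finite FL"
  using \<Lambda> finite_A by (simp add: FL_def GGMSC_program_def finite_subfms)

lemma subfms_FL: "f \<in> FL \<Longrightarrow> subfms f \<subseteq> FL"
  unfolding FL_def using subfms_trans by fastforce

lemma FL_closed:
  "Neg f \<in> FL \<Longrightarrow> f \<in> FL" "Conj f g \<in> FL \<Longrightarrow> f \<in> FL" "Conj f g \<in> FL \<Longrightarrow> g \<in> FL"
  "Dia n f \<in> FL \<Longrightarrow> f \<in> FL" "Glob n f \<in> FL \<Longrightarrow> f \<in> FL"
  using subfms_FL subfms_refl by fastforce+

lemma rules_FL: "X \<in> svars \<Lambda> \<Longrightarrow> base \<Lambda> X \<in> FL" "X \<in> svars \<Lambda> \<Longrightarrow> ind \<Lambda> X \<in> FL"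
  unfolding FL_def using subfms_refl by blast+

lemma size_FL: "f \<in> FL \<Longrightarrow> size f < depth"
  using finite_FL by (simp add: depth_def less_Suc_eq_le)

lemma grade_FL: "Glob n f \<in> FL \<Longrightarrow> n \<le> max_grade"
  using Max_ge[OF finite_imageI[OF finite_FL] imageI[of "Glob n f" FL glob_grade]]
  by (simp add: max_grade_def)

lemma Prop_FL: "p \<in> A \<union> {pb, pl, pr} \<Longrightarrow> Prop p \<in> FL"
  by (auto simp: FL_def)

lemma Var_FL: "Var X \<in> FL \<longleftrightarrow> X \<in> svars \<Lambda>"
proof -
  have "X \<in> svars \<Lambda>" if "Y \<in> svars \<Lambda>" "Var X \<in> subfms (base \<Lambda> Y) \<union> subfms (ind \<Lambda> Y)" for Y
    using \<Lambda> that by (auto simp: GGMSC_program_def dest!: Var_subfms)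
  then show ?thesis by (auto simp: FL_def)
qed

type_synonym ('p1, 'v1) cell = "bool \<times> nat \<times> ('p1, 'v1) fm set"

fun update :: "('p, 'v) cell \<Rightarrow> ('p, 'v) cell \<Rightarrow> ('p, 'v) cell \<Rightarrow> (('p, 'v) fm \<Rightarrow> nat) \<Rightarrow>
    ('p, 'v) cell" where
  "update (_, _, L) (b, j, T) (_, _, R) g =
     (if j < depth then (b, Suc j, {f \<in> FL. level_sat L T R g f})
      else (True, 0, {Prop p |p. Prop p \<in> T} \<union>
        {Var X |X. X \<in> svars \<Lambda> \<and> (if b then ind \<Lambda> X else base \<Lambda> X) \<in> T}))"

fun count :: "(('p, 'v) fm \<Rightarrow> nat) \<Rightarrow> ('p, 'v) cell \<Rightarrow> ('p, 'v) fm \<Rightarrow> nat" where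
  "count g (b, j, T) = (\<lambda>f. if f \<in> T then min max_grade (Suc (g f)) else g f)"

definition load :: "('p, 'g) tsym \<Rightarrow> ('p, 'v) cell" where
  "load a = (False, 0, {Prop (tsym_prop pb pl pr a)})"

text \<open>The value 0 outside \<open>FL\<close> makes this set finite although the functions are
  defined on all formulas.\<close>

definition counts :: "(('p, 'v) fm \<Rightarrow> nat) set" where
  "counts = {g. \<forall>f. (f \<in> FL \<longrightarrow> g f \<in> {..max_grade}) \<and> (f \<notin> FL \<longrightarrow> g f = 0)}"

definition cell_set :: "('p, 'v) cell set" where
  "cell_set = UNIV \<times> {..depth} \<times> Pow FL"

text \<open>The value for a missing neighbour has an empty set of truths, so it never counts towards
  a \<open>Dia\<close>.\<close>

sublocale aut: summary_automaton A cell_set counts "(False, 0, {})"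
  update count "\<lambda>_. 0" load
  "\<lambda>(b, j, T). \<exists>X\<in>accepting \<Lambda>. Var X \<in> T" "\<lambda>(b, j, T). \<exists>X\<in>rejecting \<Lambda>. Var X \<in> T"
proof
  show "finite A" by (rule finite_A)
  show "finite (cell_set)"
    unfolding cell_set_def using finite_FL by (intro finite_SigmaI) simp_all
  show "finite counts"
    unfolding counts_def by (rule finite_set_of_finite_funs) (simp_all add: finite_FL)
  show "(False, 0, {}) \<in> cell_set" by (simp add: cell_set_def)
  show "(\<lambda>_. 0) \<in> counts" by (simp add: counts_def)
  show "load a \<in> cell_set" if "a \<in> input_syms A" for a :: "('p, 'c) tsym"
    using that by (auto simp: cell_set_def load_def input_syms_def intro!: Prop_FL)
  show "update l c r g \<in> cell_set"
    if "c \<in> cell_set" for l c r g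
    using that by (cases l; cases c; cases r) (auto simp: cell_set_def Var_FL)
  show "count g c \<in> counts" if "g \<in> counts" "c \<in> cell_set" for g c
    using that by (cases c) (auto simp: cell_set_def counts_def)
qed

abbreviation truths :: "('p, 'v) cell \<Rightarrow> ('p, 'v) fm set" where
  "truths c \<equiv> snd (snd c)"

lemma update_eq:
  "update l c r g =
     (if fst (snd c) < depth
      then (fst c, Suc (fst (snd c)), {f \<in> FL. level_sat (truths l) (truths c) (truths r) g f})
      else (True, 0, {Prop p |p. Prop p \<in> truths c} \<union>
        {Var X |X. X \<in> svars \<Lambda> \<and> (if fst c then ind \<Lambda> X else base \<Lambda> X) \<in> truths c}))"
  by (cases l; cases c; cases r) simp

text \<open>Truncating after each increment equals truncating the total, because \<open>min
  max_grade (Suc (min max_grade x)) = min max_grade (Suc x)\<close>.\<close>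

lemma summary_count:
  "aut.summary c n f = min max_grade (card {i. i < n \<and> f \<in> truths (c i)})"
proof (induction n)
  case (Suc n)
  obtain b j T where c: "c n = (b, j, T)" by (cases "c n")
  have sum: "aut.summary c (Suc n) f =
      (if f \<in> T then min max_grade (Suc (aut.summary c n f)) else aut.summary c n f)"
    using c by simp
  show ?case
  proof (cases "f \<in> T")
    case True
    then have "{i. i < Suc n \<and> f \<in> truths (c i)} = insert n {i. i < n \<and> f \<in> truths (c i)}"
      using c by (auto simp: less_Suc_eq)
    then show ?thesis unfolding sum Suc by (simp add: True)
  next
    case False
    then have "{i. i < Suc n \<and> f \<in> truths (c i)} = {i. i < n \<and> f \<in> truths (c i)}"
      using c by (auto simp: less_Suc_eq)
    then show ?thesis unfolding sum Suc by (simp add: False)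
  qed
qed simp

section \<open>Correctness of the rounds on a fixed word\<close>

context
  fixes s :: "'p list" and k e :: nat
  assumes s: "s \<in> lists A" and e: "e = length s + k + 1"
begin

abbreviation M where "M \<equiv> ext_word_model pb pl pr k s"

text \<open>The variable values during round \<open>r\<close>. Round 0 evaluates the base rules, so
  the values of iteration \<open>n\<close> become available in round \<open>Suc n\<close>.\<close>

definition env :: "nat \<Rightarrow> 'v \<Rightarrow> nat \<Rightarrow> bool" where
  "env r X i = (case r of 0 \<Rightarrow> False | Suc n \<Rightarrow> ival \<Lambda> M n X i)"

lemma env_Suc: "env (Suc r) X i = esat M (env r) i (if 0 < r then ind \<Lambda> X else base \<Lambda> X)"
proof (cases r)
  case 0
  then have "env r = (\<lambda>_ _. False)" by (simp add: env_def fun_eq_iff)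
  then show ?thesis using 0 by (simp add: env_def ival_0)
next
  case (Suc n)
  then have "env r = ival \<Lambda> M n" by (simp add: env_def fun_eq_iff)
  then show ?thesis using Suc by (simp add: env_def ival_Suc)
qed

text \<open>Atoms have clauses of their own because they are right from the start of a round, when
  the last clause is still vacuous.\<close>

definition correct :: "nat \<Rightarrow> nat \<Rightarrow> (nat \<Rightarrow> ('p, 'v) cell) \<Rightarrow> bool" where
  "correct r j c \<longleftrightarrow> (\<forall>i\<le>e. fst (c i) = (0 < r) \<and> fst (snd (c i)) = j \<and>
     (\<forall>p. Prop p \<in> truths (c i) \<longleftrightarrow> p \<in> label M i) \<and>
     (\<forall>X. Var X \<in> truths (c i) \<longleftrightarrow> X \<in> svars \<Lambda> \<and> env r X i) \<and>
     (\<forall>f\<in>FL. size f < j \<longrightarrow> (f \<in> truths (c i) \<longleftrightarrow> esat M (env r) i f)))"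

lemma label_FL:
  assumes "i \<le> e" "p \<in> label M i"
  shows "Prop p \<in> FL"
proof (rule Prop_FL)
  have "init_tape k s ! i \<in> (input_syms A :: ('p, nat) tsym set)"
    using init_tape_input_syms[OF s, of i k] assms(1) by (simp add: e)
  moreover have "p = tsym_prop pb pl pr (init_tape k s ! i :: ('p, nat) tsym)"
    using assms label_ext_word_model[of i s k pb pl pr, where 'g = nat] by (simp add: e)
  ultimately show "p \<in> A \<union> {pb, pl, pr}" by (auto simp: input_syms_def)
qed

lemma correct_0: "correct 0 0 (aut.cells s k e 0)"
proof -
  have "aut.cells s k e 0 = (\<lambda>i. load (init_tape k s ! i :: ('p, ('p, 'v) cell \<times> ('p, 'v) cell) tsym))"
    by (simp add: aut.cells_def[OF s e])
  moreover have "label M i = {tsym_prop pb pl pr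
      (init_tape k s ! i :: ('p, ('p, 'v) cell \<times> ('p, 'v) cell) tsym)}" if "i \<le> e" for i
    using that by (simp add: label_ext_word_model e)
  ultimately show ?thesis
    unfolding correct_def by (simp add: load_def env_def)
qed

text \<open>Immediate subformulas are smaller, hence already settled at the node and at its
  neighbours, and that is all \<open>level_sat\<close> consults.\<close>

lemma correct_step:
  assumes c: "correct r j c" and j: "j < depth"
  shows "correct r (Suc j) (aut.step e c)"
proof -
  let ?g = "aut.summary c (Suc e)"
  have T: "f \<in> truths (c i) \<longleftrightarrow> esat M (env r) i f" if "f \<in> FL" "size f < j" "i \<le> e" for f i
    using c that by (simp add: correct_def)
  have P: "Prop p \<in> truths (c i) \<longleftrightarrow> p \<in> label M i" if "i \<le> e" for p i
    using c that by (simp add: correct_def)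
  have V: "Var X \<in> truths (c i) \<longleftrightarrow> X \<in> svars \<Lambda> \<and> env r X i" if "i \<le> e" for X i
    using c that by (simp add: correct_def)
  define L where "L i = truths (if i = 0 then (False, 0, {}) else c (i - 1))" for i
  define R where "R i = truths (if i < e then c (Suc i) else (False, 0, {}))" for i
  have step: "aut.step e c i = (0 < r, Suc j, {f \<in> FL. level_sat (L i) (truths (c i)) (R i) ?g f})"
    if "i \<le> e" for i
  proof -
    have "fst (c i) = (0 < r)" "fst (snd (c i)) = j"
      using c that by (simp_all add: correct_def)
    then show ?thesis
      unfolding aut.step_def update_eq L_def R_def by (simp only: j if_True)
  qed
  have lev: "level_sat (L i) (truths (c i)) (R i) ?g f \<longleftrightarrow> esat M (env r) i f"
    if f: "f \<in> FL" "size f < Suc j" and i: "i \<le> e" for f i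
  proof (cases f)
    case (Dia n f')
    then have f': "f' \<in> FL" "size f' < j" using f FL_closed(4)[of n f'] by simp_all
    have "f' \<in> L i \<longleftrightarrow> 0 < i \<and> esat M (env r) (i - 1) f'"
      "f' \<in> R i \<longleftrightarrow> i < e \<and> esat M (env r) (Suc i) f'"
      using T[OF f'] i by (auto simp: L_def R_def)
    then show ?thesis
      using at_least_neighbours[of i s k n pb pl pr "\<lambda>v. esat M (env r) v f'"] i
      by (simp only: Dia level_sat.simps esat.simps e)
  next
    case (Glob n f')
    then have f': "f' \<in> FL" "size f' < j" "n \<le> max_grade"
      using f FL_closed(5)[of n f'] grade_FL[of n f'] by simp_all
    have "{i. i < Suc e \<and> f' \<in> truths (c i)} = {v \<in> worlds M. esat M (env r) v f'}"
      using T[OF f'(1,2)] by (auto simp: e less_Suc_eq_le)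
    then have "?g f' = min max_grade (card {v \<in> worlds M. esat M (env r) v f'})"
      by (simp only: summary_count)
    \<comment> \<open>Truncation does not affect the comparison, since
      \<open>n \<le> max_grade\<close>.\<close>
    then show ?thesis
      using f'(3) by (simp add: Glob at_least_def del: aut.summary.simps)
  next
    case (Neg f')
    then show ?thesis using T[of f' i] f i FL_closed(1)[of f'] by simp
  next
    case (Conj f1 f2)
    then show ?thesis using T[of f1 i] T[of f2 i] f i FL_closed(2,3)[of f1 f2] by simp
  next
    case (Var X)
    then have "X \<in> svars \<Lambda>" using f Var_FL by simp
    then show ?thesis using Var V i by simp
  qed (use P i in simp_all)
  show ?thesis
    unfolding correct_def
  proof (intro allI impI)
    fix i assume i: "i \<le> e"
    let ?T = "{f \<in> FL. level_sat (L i) (truths (c i)) (R i) ?g f}"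
    have "Prop p \<in> ?T \<longleftrightarrow> p \<in> label M i" for p
      using P[OF i] label_FL[OF i] by (simp only: mem_Collect_eq level_sat.simps) blast
    moreover have "Var X \<in> ?T \<longleftrightarrow> X \<in> svars \<Lambda> \<and> env r X i" for X
      using V[OF i] Var_FL by (simp only: mem_Collect_eq level_sat.simps) blast
    moreover have "\<forall>f\<in>FL. size f < Suc j \<longrightarrow> (f \<in> ?T \<longleftrightarrow> esat M (env r) i f)"
      using lev i by (simp only: mem_Collect_eq) blast
    ultimately show "fst (aut.step e c i) = (0 < r) \<and> fst (snd (aut.step e c i)) = Suc j \<and>
       (\<forall>p. Prop p \<in> truths (aut.step e c i) \<longleftrightarrow> p \<in> label M i) \<and>
       (\<forall>X. Var X \<in> truths (aut.step e c i) \<longleftrightarrow> X \<in> svars \<Lambda> \<and> env r X i) \<and>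
       (\<forall>f\<in>FL. size f < Suc j \<longrightarrow> (f \<in> truths (aut.step e c i) \<longleftrightarrow> esat M (env r) i f))"
      unfolding step[OF i] fst_conv snd_conv by blast
  qed
qed

lemma correct_round:
  assumes c: "correct r depth c"
  shows "correct (Suc r) 0 (aut.step e c)"
proof -
  have "(if 0 < r then ind \<Lambda> X else base \<Lambda> X) \<in> truths (c i) \<longleftrightarrow> env (Suc r) X i"
    if "i \<le> e" "X \<in> svars \<Lambda>" for X i
  proof -
    have "(if 0 < r then ind \<Lambda> X else base \<Lambda> X) \<in> FL" using rules_FL that(2) by simp
    then show ?thesis using c that(1) size_FL unfolding env_Suc correct_def by blast
  qed
  then show ?thesis
    using c unfolding correct_def aut.step_def update_eq
    by (auto simp del: aut.summary.simps)
qed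

text \<open>A round takes \<open>Suc depth\<close> steps, \<open>depth\<close> for the levels and
  one for the reset, so quotient and remainder give the round and the phase within it.\<close>

lemma correct_cells: "correct (m div Suc depth) (m mod Suc depth) (aut.cells s k e m)"
proof (induction m)
  case 0
  show ?case using correct_0 by simp
next
  case (Suc m)
  have cells: "aut.cells s k e (Suc m) = aut.step e (aut.cells s k e m)"
    by (simp add: aut.cells_def[OF s e])
  show ?case
  proof (cases "m mod Suc depth = depth")
    case True
    then have "Suc m mod Suc depth = 0" "Suc m div Suc depth = Suc (m div Suc depth)"
      by (simp_all add: mod_Suc div_Suc)
    then show ?thesis using correct_round Suc True cells by simp
  next
    case False
    then have "Suc m mod Suc depth = Suc (m mod Suc depth)" "Suc m div Suc depth = m div Suc depth"
      by (simp_all add: mod_Suc div_Suc)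
    moreover have "m mod Suc depth < depth"
      using False mod_less_divisor[of "Suc depth" m] by linarith
    ultimately show ?thesis using correct_step Suc cells by simp
  qed
qed

lemma output_cells:
  assumes "Q \<subseteq> svars \<Lambda>"
  shows "(case aut.cells s k e m 1 of (b, j, T) \<Rightarrow> \<exists>X\<in>Q. Var X \<in> T) \<longleftrightarrow>
    (\<exists>X\<in>Q. env (m div Suc depth) X 1)"
proof -
  have "1 \<le> e" by (simp add: e)
  then show ?thesis
    using correct_cells[of m] assms unfolding correct_def by (auto simp: split_beta)
qed

lemma accepts_iff: "tm_accepts k aut.TM s \<longleftrightarrow> k_accepts pb pl pr k \<Lambda> s"
  and rejects_iff: "tm_rejects k aut.TM s \<longleftrightarrow> k_rejects pb pl pr k \<Lambda> s"
proof -
  have sub: "accepting \<Lambda> \<subseteq> svars \<Lambda>" "rejecting \<Lambda> \<subseteq> svars \<Lambda>"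
    using \<Lambda> by (auto simp: GGMSC_program_def)
  note out = output_cells[OF sub(1)] output_cells[OF sub(2)]
  have hit: "(\<exists>m. (\<exists>X\<in>Q. env (m div Suc depth) X 1) \<and>
        (\<forall>j\<le>m. \<not> (\<exists>X\<in>Q'. env (j div Suc depth) X 1))) \<longleftrightarrow>
      (\<exists>n. (\<exists>X\<in>Q. ival \<Lambda> M n X 1) \<and> (\<forall>j\<le>n. \<not> (\<exists>X\<in>Q'. ival \<Lambda> M j X 1)))" for Q Q'
    \<comment> \<open>The lemma applies because \<open>env 0\<close> is false everywhere and
      \<open>env (Suc n)\<close> is iteration \<open>n\<close>.\<close>
    using first_hit_dilate[of "Suc depth" "\<lambda>r. \<exists>X\<in>Q. env r X 1" "\<lambda>r. \<exists>X\<in>Q'. env r X 1"]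
    by (simp add: env_def)
  show "tm_accepts k aut.TM s \<longleftrightarrow> k_accepts pb pl pr k \<Lambda> s"
    unfolding aut.tm_accepts_TM[OF s e] out hit k_accepts_def program_accepts_ival ..
  show "tm_rejects k aut.TM s \<longleftrightarrow> k_rejects pb pl pr k \<Lambda> s"
    unfolding aut.tm_rejects_TM[OF s e] out hit k_rejects_def program_rejects_ival ..
qed

end

end


section \<open>The equivalence\<close>

text \<open>The machine is fixed before \<open>k\<close>, so a single machine serves every bound.
  Finiteness of its states and symbols gives the injections into \<open>nat\<close>.\<close>

lemma machine_of_program:
  fixes \<Lambda> :: "('p, 'v) program"
  assumes "finite A" "GGMSC_program (A \<union> {pb, pl, pr}) \<Lambda>"
  obtains T :: "'p machine" where "bounded_TM A T"
    "\<And>k s. s \<in> lists A \<Longrightarrow> tm_accepts k T s = k_accepts pb pl pr k \<Lambda> s"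
    "\<And>k s. s \<in> lists A \<Longrightarrow> tm_rejects k T s = k_rejects pb pl pr k \<Lambda> s"
proof -
  interpret program_to_tm A pb pl pr \<Lambda>
    using assms by unfold_locales
  let ?T = aut.TM
  have fin: "finite (tm_states ?T)" "finite (tm_symbols ?T)"
    using aut.bounded_TM by (simp_all add: bounded_TM_def)
  have "finite {x. Work x \<in> tm_symbols ?T}"
    using finite_vimageI[OF fin(2), of Work] by (simp add: vimage_def inj_def)
  then obtain g :: "_ \<Rightarrow> nat" where g: "inj_on g {x. Work x \<in> tm_symbols ?T}"
    using finite_imp_inj_to_nat_seg by blast
  obtain f :: "_ \<Rightarrow> nat" where f: "inj_on f (tm_states ?T)"
    using finite_imp_inj_to_nat_seg[OF fin(1)] by blast
  from rename_bounded_TM[OF aut.bounded_TM f g] obtain T :: "'p machine" where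
    T: "bounded_TM A T"
    "\<And>k s. s \<in> lists A \<Longrightarrow> tm_accepts k T s = tm_accepts k ?T s"
    "\<And>k s. s \<in> lists A \<Longrightarrow> tm_rejects k T s = tm_rejects k ?T s"
    by blast
  have "tm_accepts k T s = k_accepts pb pl pr k \<Lambda> s" "tm_rejects k T s = k_rejects pb pl pr k \<Lambda> s"
    if "s \<in> lists A" for k s
    unfolding T(2,3)[OF that] by (rule accepts_iff[OF that refl] rejects_iff[OF that refl])+
  with T(1) show ?thesis by (rule that)
qed

lemma program_of_machine:
  fixes T :: "('q, 'g, 'p) tm"
  assumes T: "bounded_TM A T" and "pb \<notin> A" "pl \<notin> A" "pr \<notin> A" "distinct [pb, pl, pr]"
  obtains \<Lambda> :: "'p prog" where "MSC_program (A \<union> {pb, pl, pr}) \<Lambda>"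
    "\<And>k s. s \<in> lists A \<Longrightarrow> k_accepts pb pl pr k \<Lambda> s = tm_accepts k T s"
    "\<And>k s. s \<in> lists A \<Longrightarrow> k_rejects pb pl pr k \<Lambda> s = tm_rejects k T s"
proof -
  have fin: "finite (tm_states T)" "finite (tm_symbols T)"
    using T by (simp_all add: bounded_TM_def)
  obtain qs where qs: "set qs = tm_states T" using finite_list[OF fin(1)] by blast
  obtain as where as: "set as = tm_symbols T" using finite_list[OF fin(2)] by blast
  interpret tm_to_program A pb pl pr T qs as
    by unfold_locales (use assms qs as in simp_all)
  have "finite (svars sim_program)" by (simp add: sim_program_def)
  then obtain r :: "_ \<Rightarrow> nat" where "inj_on r (svars sim_program)"
    using finite_imp_inj_to_nat_seg by blast
  from rename_MSC_program[OF MSC_sim_program this] obtain \<Lambda> :: "'p prog" where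
    "MSC_program (A \<union> {pb, pl, pr}) \<Lambda>"
    "\<And>(M :: (nat, 'p) kripke) w. program_accepts \<Lambda> M w = program_accepts sim_program M w"
    "\<And>(M :: (nat, 'p) kripke) w. program_rejects \<Lambda> M w = program_rejects sim_program M w"
    by blast
  note \<Lambda> = this
  have "k_accepts pb pl pr k \<Lambda> s = tm_accepts k T s" "k_rejects pb pl pr k \<Lambda> s = tm_rejects k T s"
    if "s \<in> lists A" for k s
    using k_accepts_sim_program[OF that refl, of k] k_rejects_sim_program[OF that refl, of k]
    unfolding k_accepts_def k_rejects_def \<Lambda>(2,3) .
  with \<Lambda>(1) show ?thesis by (rule that)
qed

theorem mainTheorem6:
  fixes A :: "'p set" and pb pl pr :: 'p
  assumes "finite A"
    and "pb \<notin> A" and "pl \<notin> A" and "pr \<notin> A"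
    and "distinct [pb, pl, pr]"
  shows "(\<forall>L. (linear_TM_language A L \<longleftrightarrow> GGMSC_language A pb pl pr L) \<and>
              (linear_TM_language A L \<longleftrightarrow> GMSC_language A pb pl pr L) \<and>
              (linear_TM_language A L \<longleftrightarrow> MSC_language A pb pl pr L))
       \<and> (\<forall>(\<Lambda> :: 'p prog) k. GGMSC_program (A \<union> {pb, pl, pr}) \<Lambda> \<longrightarrow>
            (\<exists>T :: 'p machine. bounded_TM A T \<and>
              (\<forall>w \<in> lists A.
                 (k_accepts pb pl pr k \<Lambda> w \<longrightarrow> tm_accepts k T w) \<and>
                 (k_rejects pb pl pr k \<Lambda> w \<longrightarrow> tm_rejects k T w))))
       \<and> (\<forall>(T :: 'p machine) k. bounded_TM A T \<longrightarrow>
            (\<exists>\<Lambda> :: 'p prog. MSC_program (A \<union> {pb, pl, pr}) \<Lambda> \<and>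
              (\<forall>w \<in> lists A.
                 (tm_accepts k T w \<longrightarrow> k_accepts pb pl pr k \<Lambda> w) \<and>
                 (tm_rejects k T w \<longrightarrow> k_rejects pb pl pr k \<Lambda> w))))"
proof -
  let ?P = "A \<union> {pb, pl, pr}"
  have MT: "\<exists>T :: 'p machine. bounded_TM A T \<and> (\<forall>k. \<forall>w\<in>lists A.
      (tm_accepts k T w \<longleftrightarrow> k_accepts pb pl pr k \<Lambda> w) \<and>
      (tm_rejects k T w \<longleftrightarrow> k_rejects pb pl pr k \<Lambda> w))"
    if "GGMSC_program ?P \<Lambda>" for \<Lambda> :: "'p prog"
    using machine_of_program[OF assms(1) that] by metis
  have PM: "\<exists>\<Lambda> :: 'p prog. MSC_program ?P \<Lambda> \<and> (\<forall>k. \<forall>w\<in>lists A.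
      (k_accepts pb pl pr k \<Lambda> w \<longleftrightarrow> tm_accepts k T w) \<and>
      (k_rejects pb pl pr k \<Lambda> w \<longleftrightarrow> tm_rejects k T w))"
    if "bounded_TM A T" for T :: "'p machine"
    using program_of_machine[OF that assms(2-5)] by metis
  \<comment> \<open>Program and machine use the same \<open>k\<close>, and the equivalence in
    \<open>MT\<close> also settles the words outside \<open>L\<close>.\<close>
  have lang1: "linear_TM_language A L" if L: "GGMSC_language A pb pl pr L" for L
  proof -
    from L obtain \<Lambda> :: "'p prog" and k where "GGMSC_program ?P \<Lambda>" "L \<subseteq> lists A"
      "\<forall>s\<in>lists A. k_accepts pb pl pr k \<Lambda> s \<longleftrightarrow> s \<in> L"
      unfolding GGMSC_language_def program_recognizes_def by blast
    moreover from MT[OF this(1)] obtain T :: "'p machine" where "bounded_TM A T"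
      "\<forall>k. \<forall>w\<in>lists A. tm_accepts k T w \<longleftrightarrow> k_accepts pb pl pr k \<Lambda> w"
      by blast
    ultimately show ?thesis
      unfolding linear_TM_language_def tm_recognizes_def by metis
  qed
  have lang2: "MSC_language A pb pl pr L" if L: "linear_TM_language A L" for L
  proof -
    from L obtain k and T :: "'p machine" where "bounded_TM A T" "L \<subseteq> lists A"
      "\<forall>s\<in>lists A. tm_accepts k T s \<longleftrightarrow> s \<in> L"
      unfolding linear_TM_language_def tm_recognizes_def by blast
    moreover from PM[OF this(1)] obtain \<Lambda> :: "'p prog" where "MSC_program ?P \<Lambda>"
      "\<forall>k. \<forall>w\<in>lists A. k_accepts pb pl pr k \<Lambda> w \<longleftrightarrow> tm_accepts k T w"
      by blast
    ultimately show ?thesis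
      unfolding MSC_language_def program_recognizes_def by metis
  qed
  \<comment> \<open>These inclusions close the cycle, so that all four classes coincide.\<close>
  have "MSC_language A pb pl pr L \<Longrightarrow> GMSC_language A pb pl pr L"
    "GMSC_language A pb pl pr L \<Longrightarrow> GGMSC_language A pb pl pr L" for L
    unfolding MSC_language_def GMSC_language_def GGMSC_language_def MSC_program_def GMSC_program_def
    by blast+
  with lang1 lang2 have "(linear_TM_language A L \<longleftrightarrow> GGMSC_language A pb pl pr L) \<and>
      (linear_TM_language A L \<longleftrightarrow> GMSC_language A pb pl pr L) \<and>
      (linear_TM_language A L \<longleftrightarrow> MSC_language A pb pl pr L)" for L
    by blast
  then show ?thesis using MT PM by meson
qed

end
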